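(* Let $$\mathcal{G}:=\mathbb{R}^4\setminus\left\{\left(x_1,x_2,\tfrac{-x_1}{x_1^2+x_2^2},\tfrac{-x_2}{x_1^2+x_2^2}\right):(x_1,x_2)\neq 0\right\},$$ and let $\varphi:\mathcal{G}\setminus(\{0\}\times\mathbb{R}^2)\to(\mathbb{R}^2\setminus\{0\})\times(\mathbb{R}^2\setminus\{0\})$ be the diffeomorphism $$\varphi(x_1,x_2,a,b)=(x_1,x_2,\,a(x_1^2+x_2^2)+x_1,\,b(x_1^2+x_2^2)+x_2).$$ Then the pair groupoid structure on $(\mathbb{R}^2\setminus\{0\})\times(\mathbb{R}^2\setminus\{0\})$, pulled back to $\mathcal{G}\setminus(\{0\}\times\mathbb{R}^2)$ along $\varphi$, extends uniquely to a Lie groupoid structure $\mathcal{G}\rightrightarrows\mathbb{R}^2$, which integrates $\mathcal{A}$, the cotangent Lie algebroid of an elliptic Poisson structure on $(\mathbb{R}^2,\{0\})$.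
   Context: On $\mathbb{R}^2$ with coordinates $(x_1,x_2)$ and polar coordinates $(r,\theta)$, take the divisor $D=\{0\}$ with elliptic ideal $\langle r^2\rangle$. The elliptic tangent bundle $\mathcal{A}_{|D|}$ is the Lie algebroid with anchor $\rho$ whose sections are the vector fields preserving this ideal, generated by $r\partial_r$ and $\partial_\theta$. An elliptic symplectic form is a nondegenerate closed $\omega\in\Gamma(\Lambda^2\mathcal{A}_{|D|}^* )$; here $\omega=f\,d\log r\wedge d\theta$ for a nowhere vanishing $f\in C^\infty(\mathbb{R}^2)$. The associated elliptic Poisson structure is the bivector $\pi$ with $\pi^\sharp=\rho\circ(\omega^\flat)^{-1}\circ\rho^*:T^*M\to TM$, here $\pi=\tfrac{r^2}{f}\partial_{x_1}\wedge\partial_{x_2}$ (up to sign convention). Its cotangent Lie algebroid is $\mathcal{A}=(T^*\mathbb{R}^2,\pi^\sharp,[-,-]_\pi)$; it is isomorphic to the Lie algebroid whose sections are the vector fields spanned by $r^2\partial_{x_1},r^2\partial_{x_2}$. The pair groupoid of $X$ is $X\times X\rightrightarrows X$ with target $\mathrm{pr}_1$, source $\mathrm{pr}_2$ and $(x,y)(y,z)=(x,z)$. The Lie algebroid of a Lie groupoid is $\ker(ds)$ at the units with anchor $dt$; a groupoid integrates $\mathcal{A}$ if its Lie algebroid is isomorphic to $\mathcal{A}$ over the identity. *)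

theory Defs
  imports "HOL-Analysis.Analysis"
begin

section \<open>Smooth maps\<close>

text \<open>
  For \<^term>\<open>S\<close> open in a finite-dimensional space, \<open>Ck_on k S f\<close> is the usual class of
  \<open>k\<close> times continuously differentiable maps. A map on an arbitrary subset (such as an embedded
  submanifold) is smooth if near each point of the subset it extends to a smooth map on an open set.
\<close>

primrec Ck_on :: "nat \<Rightarrow> 'a::real_normed_vector set \<Rightarrow> ('a \<Rightarrow> 'b::real_normed_vector) \<Rightarrow> bool" where
  "Ck_on 0 S f \<longleftrightarrow> continuous_on S f"
| "Ck_on (Suc k) S f \<longleftrightarrow>
     (\<forall>x\<in>S. f differentiable (at x)) \<and> (\<forall>v. Ck_on k S (\<lambda>x. frechet_derivative f (at x) v))"

definition smooth_on :: "'a::real_normed_vector set \<Rightarrow> ('a \<Rightarrow> 'b::real_normed_vector) \<Rightarrow> bool" where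
  "smooth_on A f \<longleftrightarrow>
     (\<forall>x\<in>A. \<exists>U g. open U \<and> x \<in> U \<and> (\<forall>k. Ck_on k U g) \<and> (\<forall>y\<in>U \<inter> A. g y = f y))"

definition diffeomorphism_on ::
    "('a::real_normed_vector \<Rightarrow> 'b::real_normed_vector) \<Rightarrow> 'a set \<Rightarrow> 'b set \<Rightarrow> bool" where
  "diffeomorphism_on f A B \<longleftrightarrow> bij_betw f A B \<and> smooth_on A f \<and> smooth_on B (inv_into A f)"

definition lie_bracket :: "('a::real_normed_vector \<Rightarrow> 'a) \<Rightarrow> ('a \<Rightarrow> 'a) \<Rightarrow> 'a \<Rightarrow> 'a" where
  "lie_bracket X Y p = frechet_derivative Y (at p) (X p) - frechet_derivative X (at p) (Y p)"


section \<open>Lie groupoids\<close>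

text \<open>\<open>mult H (g, h)\<close> is the product \<open>gh\<close>, defined when \<open>src H g = tgt H h\<close>.\<close>

record ('g, 'm) groupoid =
  arrows :: "'g set"
  objects :: "'m set"
  src :: "'g \<Rightarrow> 'm"
  tgt :: "'g \<Rightarrow> 'm"
  mult :: "'g \<times> 'g \<Rightarrow> 'g"
  unit_at :: "'m \<Rightarrow> 'g"
  inverse_of :: "'g \<Rightarrow> 'g"

definition composable :: "('g, 'm) groupoid \<Rightarrow> ('g \<times> 'g) set" where
  "composable H = {(g, h). g \<in> arrows H \<and> h \<in> arrows H \<and> src H g = tgt H h}"

text \<open>
  The extensionality conditions fix the values of the structure maps outside their domains, so that
  equality of records is equality of groupoid structures.
\<close>

definition is_groupoid :: "('g, 'm) groupoid \<Rightarrow> bool" where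
  "is_groupoid H \<longleftrightarrow>
     src H \<in> arrows H \<rightarrow>\<^sub>E objects H \<and>
     tgt H \<in> arrows H \<rightarrow>\<^sub>E objects H \<and>
     mult H \<in> composable H \<rightarrow>\<^sub>E arrows H \<and>
     unit_at H \<in> objects H \<rightarrow>\<^sub>E arrows H \<and>
     inverse_of H \<in> arrows H \<rightarrow>\<^sub>E arrows H \<and>
     (\<forall>(g, h)\<in>composable H. src H (mult H (g, h)) = src H h \<and> tgt H (mult H (g, h)) = tgt H g) \<and>
     (\<forall>g h k. (g, h) \<in> composable H \<and> (h, k) \<in> composable H \<longrightarrow>
        mult H (mult H (g, h), k) = mult H (g, mult H (h, k))) \<and>
     (\<forall>x\<in>objects H. src H (unit_at H x) = x \<and> tgt H (unit_at H x) = x) \<and>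
     (\<forall>g\<in>arrows H. mult H (unit_at H (tgt H g), g) = g \<and> mult H (g, unit_at H (src H g)) = g) \<and>
     (\<forall>g\<in>arrows H. src H (inverse_of H g) = tgt H g \<and> tgt H (inverse_of H g) = src H g \<and>
        mult H (g, inverse_of H g) = unit_at H (tgt H g) \<and>
        mult H (inverse_of H g, g) = unit_at H (src H g))"

text \<open>Lie groupoids whose manifolds of arrows and objects are open subsets of Euclidean spaces.\<close>

definition lie_groupoid :: "('g::euclidean_space, 'm::euclidean_space) groupoid \<Rightarrow> bool" where
  "lie_groupoid H \<longleftrightarrow>
     is_groupoid H \<and> open (arrows H) \<and> open (objects H) \<and>
     smooth_on (arrows H) (src H) \<and> smooth_on (arrows H) (tgt H) \<and>
     (\<forall>g\<in>arrows H. surj (frechet_derivative (src H) (at g)) \<and>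
                    surj (frechet_derivative (tgt H) (at g))) \<and>
     smooth_on (composable H) (mult H) \<and>
     smooth_on (objects H) (unit_at H) \<and>
     smooth_on (arrows H) (inverse_of H)"

definition pair_groupoid :: "'a set \<Rightarrow> ('a \<times> 'a, 'a) groupoid" where
  "pair_groupoid X =
     \<lparr>arrows = X \<times> X, objects = X,
      src = restrict snd (X \<times> X), tgt = restrict fst (X \<times> X),
      mult = (\<lambda>(g, h)\<in>{(g, h). g \<in> X \<times> X \<and> h \<in> X \<times> X \<and> snd g = fst h}. (fst g, snd h)),
      unit_at = (\<lambda>x\<in>X. (x, x)), inverse_of = (\<lambda>(x, y)\<in>X \<times> X. (y, x))\<rparr>"

text \<open>Transport of a groupoid structure along a bijection \<open>f\<close> from \<open>U\<close> onto its arrows.\<close>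

definition pullback_groupoid ::
    "('h \<Rightarrow> 'g) \<Rightarrow> 'h set \<Rightarrow> ('g, 'm) groupoid \<Rightarrow> ('h, 'm) groupoid" where
  "pullback_groupoid f U K =
     \<lparr>arrows = U, objects = objects K,
      src = (\<lambda>g\<in>U. src K (f g)), tgt = (\<lambda>g\<in>U. tgt K (f g)),
      mult = (\<lambda>(g, h)\<in>{(g, h). g \<in> U \<and> h \<in> U \<and> src K (f g) = tgt K (f h)}.
                inv_into U f (mult K (f g, f h))),
      unit_at = (\<lambda>x\<in>objects K. inv_into U f (unit_at K x)),
      inverse_of = (\<lambda>g\<in>U. inv_into U f (inverse_of K (f g)))\<rparr>"

definition extends_groupoid :: "('g, 'm) groupoid \<Rightarrow> ('g, 'm) groupoid \<Rightarrow> bool" where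
  "extends_groupoid H K \<longleftrightarrow>
     arrows K \<subseteq> arrows H \<and> objects K \<subseteq> objects H \<and>
     (\<forall>g\<in>arrows K. src H g = src K g \<and> tgt H g = tgt K g \<and> inverse_of H g = inverse_of K g) \<and>
     (\<forall>p\<in>composable K. mult H p = mult K p) \<and>
     (\<forall>x\<in>objects K. unit_at H x = unit_at K x)"


section \<open>Lie algebroids\<close>

text \<open>
  The data of a Lie algebroid over an open set \<open>base\<close>. The vector bundle is a subbundle
  of the trivial bundle with fibre \<open>'e\<close>; anchor and bracket are only relevant on
  elements of the fibres and on smooth sections, respectively.
\<close>

record ('e, 'm) algebroid =
  base :: "'m set"
  fibre :: "'m \<Rightarrow> 'e set"
  anchor :: "'m \<Rightarrow> 'e \<Rightarrow> 'm"
  bracket :: "('m \<Rightarrow> 'e) \<Rightarrow> ('m \<Rightarrow> 'e) \<Rightarrow> 'm \<Rightarrow> 'e"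

definition sections ::
    "('e::real_normed_vector, 'm::euclidean_space) algebroid \<Rightarrow> ('m \<Rightarrow> 'e) set" where
  "sections A = {\<sigma>. smooth_on (base A) \<sigma> \<and> (\<forall>x\<in>base A. \<sigma> x \<in> fibre A x)}"

definition total_space :: "('e, 'm) algebroid \<Rightarrow> ('m \<times> 'e) set" where
  "total_space A = {(x, v). x \<in> base A \<and> v \<in> fibre A x}"

text \<open>Isomorphism of Lie algebroids over the identity of the base.\<close>

definition algebroid_iso ::
    "('e::real_normed_vector, 'm::euclidean_space) algebroid \<Rightarrow>
     ('f::real_normed_vector, 'm) algebroid \<Rightarrow> ('m \<Rightarrow> 'e \<Rightarrow> 'f) \<Rightarrow> bool" where
  "algebroid_iso A B \<Phi> \<longleftrightarrow>
     base A = base B \<and>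
     (\<forall>x\<in>base A. bij_betw (\<Phi> x) (fibre A x) (fibre B x) \<and>
        (\<forall>v\<in>fibre A x. \<forall>w\<in>fibre A x. \<Phi> x (v + w) = \<Phi> x v + \<Phi> x w) \<and>
        (\<forall>c. \<forall>v\<in>fibre A x. \<Phi> x (c *\<^sub>R v) = c *\<^sub>R \<Phi> x v)) \<and>
     smooth_on (total_space A) (\<lambda>(x, v). \<Phi> x v) \<and>
     smooth_on (total_space B) (\<lambda>(x, w). inv_into (fibre A x) (\<Phi> x) w) \<and>
     (\<forall>x\<in>base A. \<forall>v\<in>fibre A x. anchor B x (\<Phi> x v) = anchor A x v) \<and>
     (\<forall>\<sigma>\<in>sections A. \<forall>\<tau>\<in>sections A. \<forall>x\<in>base A.
        \<Phi> x (bracket A \<sigma> \<tau> x) = bracket B (\<lambda>y. \<Phi> y (\<sigma> y)) (\<lambda>y. \<Phi> y (\<tau> y)) x)"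

text \<open>
  The right-invariant vector field of a section \<open>\<sigma>\<close> of \<open>ker(ds)\<close> along the units: its value at
  \<open>g\<close> is \<open>d(R\<^sub>g)(\<sigma> (t g))\<close>, where the right translation \<open>R\<^sub>g(k) = k g\<close> is defined on the
  source fibre over \<open>t g\<close>. A derivative within this submanifold is determined only on
  vectors tangent to it; \<open>\<sigma> (t g)\<close> is such a vector.
\<close>

definition right_invariant ::
    "('g::euclidean_space, 'm::euclidean_space) groupoid \<Rightarrow> ('m \<Rightarrow> 'g) \<Rightarrow> 'g \<Rightarrow> 'g" where
  "right_invariant H \<sigma> g =
     frechet_derivative (\<lambda>k. mult H (k, g))
       (at (unit_at H (tgt H g)) within {k \<in> arrows H. src H k = tgt H g})
       (\<sigma> (tgt H g))"

definition algebroid_of ::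
    "('g::euclidean_space, 'm::euclidean_space) groupoid \<Rightarrow> ('g, 'm) algebroid" where
  "algebroid_of H =
     \<lparr>base = objects H,
      fibre = (\<lambda>x. {v. frechet_derivative (src H) (at (unit_at H x)) v = 0}),
      anchor = (\<lambda>x. frechet_derivative (tgt H) (at (unit_at H x))),
      bracket = (\<lambda>\<sigma> \<tau> x.
        lie_bracket (right_invariant H \<sigma>) (right_invariant H \<tau>) (unit_at H x))\<rparr>"

definition integrates ::
    "('g::euclidean_space, 'm::euclidean_space) groupoid \<Rightarrow>
     ('e::real_normed_vector, 'm) algebroid \<Rightarrow> bool" where
  "integrates H A \<longleftrightarrow> (\<exists>\<Phi>. algebroid_iso (algebroid_of H) A \<Phi>)"


section \<open>Cotangent Lie algebroids\<close>

text \<open>One-forms on \<open>'m\<close> are maps \<open>'m \<Rightarrow> ('m \<Rightarrow>\<^sub>L real)\<close>.\<close>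

definition exterior_d :: "('m::euclidean_space \<Rightarrow> real) \<Rightarrow> 'm \<Rightarrow> ('m \<Rightarrow>\<^sub>L real)" where
  "exterior_d h x = Blinfun (frechet_derivative h (at x))"

definition lie_derivative ::
    "('m::euclidean_space \<Rightarrow> 'm) \<Rightarrow> ('m \<Rightarrow> ('m \<Rightarrow>\<^sub>L real)) \<Rightarrow> 'm \<Rightarrow> ('m \<Rightarrow>\<^sub>L real)" where
  "lie_derivative X \<beta> x =
     Blinfun (\<lambda>v. blinfun_apply (frechet_derivative \<beta> (at x) (X x)) v
                + blinfun_apply (\<beta> x) (frechet_derivative X (at x) v))"

text \<open>
  \<open>P\<close> is the map \<open>\<pi>\<^sup>\<sharp>\<close>, so \<open>\<pi>(\<alpha>, \<beta>) = \<beta>(P \<alpha>)\<close> and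
  \<open>[\<alpha>, \<beta>]\<^sub>\<pi> = L\<^bsub>P \<alpha>\<^esub> \<beta> - L\<^bsub>P \<beta>\<^esub> \<alpha> - d(\<pi>(\<alpha>, \<beta>))\<close>.
\<close>

definition cotangent_algebroid ::
    "('m::euclidean_space \<Rightarrow> ('m \<Rightarrow>\<^sub>L real) \<Rightarrow> 'm) \<Rightarrow> ('m \<Rightarrow>\<^sub>L real, 'm) algebroid" where
  "cotangent_algebroid P =
     \<lparr>base = UNIV, fibre = (\<lambda>_. UNIV), anchor = P,
      bracket = (\<lambda>\<alpha> \<beta> x.
         lie_derivative (\<lambda>y. P y (\<alpha> y)) \<beta> x - lie_derivative (\<lambda>y. P y (\<beta> y)) \<alpha> x
         - exterior_d (\<lambda>y. blinfun_apply (\<beta> y) (P y (\<alpha> y))) x)\<rparr>"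


section \<open>Elliptic geometry of the plane with divisor the origin\<close>

text \<open>
  The elliptic tangent bundle is trivialised by its global frame \<open>r \<partial>\<^sub>r = x\<^sub>1 \<partial>\<^sub>1 + x\<^sub>2 \<partial>\<^sub>2\<close> and
  \<open>\<partial>\<^sub>\<theta> = - x\<^sub>2 \<partial>\<^sub>1 + x\<^sub>1 \<partial>\<^sub>2\<close>: the vector \<open>c\<close> in the fibre over \<open>x\<close> stands for
  \<open>c\<^sub>1 r \<partial>\<^sub>r + c\<^sub>2 \<partial>\<^sub>\<theta>\<close>. These two vector fields commute, hence the form of the bracket.
\<close>

definition elliptic_anchor :: "real^2 \<Rightarrow> real^2 \<Rightarrow> real^2" where
  "elliptic_anchor x c = c$1 *\<^sub>R x + c$2 *\<^sub>R vector [- (x$2), x$1]"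

definition elliptic_tangent_bundle :: "(real^2, real^2) algebroid" where
  "elliptic_tangent_bundle =
     \<lparr>base = UNIV, fibre = (\<lambda>_. UNIV), anchor = elliptic_anchor,
      bracket = (\<lambda>a b x. frechet_derivative b (at x) (elliptic_anchor x (a x))
                       - frechet_derivative a (at x) (elliptic_anchor x (b x)))\<rparr>"

text \<open>
  Algebroid two-forms \<open>\<omega>\<close> are given by their values \<open>\<omega> x a b\<close> on fibre elements. Closedness is
  \<open>d \<omega> = 0\<close> for the Chevalley-Eilenberg differential of the algebroid.
\<close>

definition closed_form ::
    "('e::real_normed_vector, 'm::euclidean_space) algebroid \<Rightarrow> ('m \<Rightarrow> 'e \<Rightarrow> 'e \<Rightarrow> real) \<Rightarrow> bool" where
  "closed_form A \<omega> \<longleftrightarrow>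
     (\<forall>a\<in>sections A. \<forall>b\<in>sections A. \<forall>c\<in>sections A. \<forall>x\<in>base A.
        frechet_derivative (\<lambda>y. \<omega> y (b y) (c y)) (at x) (anchor A x (a x))
      + frechet_derivative (\<lambda>y. \<omega> y (c y) (a y)) (at x) (anchor A x (b x))
      + frechet_derivative (\<lambda>y. \<omega> y (a y) (b y)) (at x) (anchor A x (c x))
      - \<omega> x (bracket A a b x) (c x) - \<omega> x (bracket A b c x) (a x) - \<omega> x (bracket A c a x) (b x)
      = 0)"

definition elliptic_symplectic :: "(real^2 \<Rightarrow> real^2 \<Rightarrow> real^2 \<Rightarrow> real) \<Rightarrow> bool" where
  "elliptic_symplectic \<omega> \<longleftrightarrow>
     (\<forall>x. bilinear (\<omega> x)) \<and> (\<forall>x a. \<omega> x a a = 0) \<and>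
     (\<forall>a b. smooth_on UNIV (\<lambda>x. \<omega> x a b)) \<and>
     (\<forall>x a. (\<forall>b. \<omega> x a b = 0) \<longrightarrow> a = 0) \<and>
     closed_form elliptic_tangent_bundle \<omega>"

text \<open>\<open>\<pi>\<^sup>\<sharp> = \<rho> \<circ> (\<omega>\<^sup>\<flat>)\<^sup>-\<^sup>1 \<circ> \<rho>\<^sup>*\<close> with the convention \<open>\<omega>\<^sup>\<flat>(a) = \<omega>(a, \<cdot>)\<close>.\<close>

definition elliptic_poisson ::
    "(real^2 \<Rightarrow> real^2 \<Rightarrow> real^2 \<Rightarrow> real) \<Rightarrow> real^2 \<Rightarrow> ((real^2) \<Rightarrow>\<^sub>L real) \<Rightarrow> real^2" where
  "elliptic_poisson \<omega> x \<alpha> =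
     elliptic_anchor x (THE a. \<forall>b. \<omega> x a b = blinfun_apply \<alpha> (elliptic_anchor x b))"

text \<open>Elliptic symplectic forms exist: \<open>d log r \<and> d \<theta>\<close> is one.\<close>

lemma smooth_on_const: "smooth_on A (\<lambda>x. c)"
proof -
  have "Ck_on k U (\<lambda>x. c)" for k and U :: "'a set" and c :: 'b
    by (induction k arbitrary: c) simp_all
  then show ?thesis
    unfolding smooth_on_def by (intro ballI exI[of _ UNIV] exI[of _ "\<lambda>x. c"]) auto
qed

lemma smooth_on_UNIV_imp_differentiable:
  assumes "smooth_on UNIV f"
  shows "f differentiable (at x)"
proof -
  obtain U g where U: "open U" "x \<in> U" "\<forall>k. Ck_on k U g" "\<forall>y\<in>U. g y = f y"
    using assms unfolding smooth_on_def by (metis Int_UNIV_right UNIV_I)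
  have "Ck_on (Suc 0) U g"
    using U(3) by blast
  then obtain D where "(g has_derivative D) (at x)"
    using U(2) by (auto simp: differentiable_def)
  then have "(f has_derivative D) (at x)"
    using U by (auto intro: has_derivative_transform_within_open)
  then show ?thesis
    by (auto simp: differentiable_def)
qed

lemma elliptic_symplectic_dlogr_dtheta:
  "elliptic_symplectic (\<lambda>x a b. a$1 * b$2 - a$2 * b$1)"
proof -
  have bil: "bilinear (\<lambda>a b :: real^2. a$1 * b$2 - a$2 * b$1)"
    by (auto simp: bilinear_def algebra_simps intro!: linearI)
  have nondeg: "a = 0" if "\<forall>b :: real^2. a$1 * b$2 - a$2 * b$1 = 0" for a :: "real^2"
    using that[rule_format, of "axis 2 1"] that[rule_format, of "axis 1 1"]
    by (simp add: vec_eq_iff forall_2 axis_def)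
  have der: "frechet_derivative (\<lambda>y. a y$1 * b y$2 - a y$2 * b y$1) (at x) v =
      frechet_derivative a (at x) v $1 * b x$2 - frechet_derivative a (at x) v $2 * b x$1
      + (a x$1 * frechet_derivative b (at x) v $2 - a x$2 * frechet_derivative b (at x) v $1)"
    if "smooth_on UNIV a" "smooth_on UNIV b" for a b :: "real^2 \<Rightarrow> real^2" and x v
  proof -
    have [derivative_intros]: "(a has_derivative frechet_derivative a (at x)) (at x)"
        "(b has_derivative frechet_derivative b (at x)) (at x)"
      using that smooth_on_UNIV_imp_differentiable frechet_derivative_works by blast+
    have "((\<lambda>y. a y$1 * b y$2 - a y$2 * b y$1) has_derivative
       (\<lambda>v. frechet_derivative a (at x) v $1 * b x$2 - frechet_derivative a (at x) v $2 * b x$1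
      + (a x$1 * frechet_derivative b (at x) v $2 - a x$2 * frechet_derivative b (at x) v $1))) (at x)"
      by (auto intro!: derivative_eq_intros bounded_linear.has_derivative[OF bounded_linear_vec_nth]
          simp: algebra_simps)
    from fun_cong[OF frechet_derivative_at[OF this]] show ?thesis by simp
  qed
  have "closed_form elliptic_tangent_bundle (\<lambda>x a b. a$1 * b$2 - a$2 * b$1)"
    unfolding closed_form_def elliptic_tangent_bundle_def sections_def
    by (simp add: der) (simp add: algebra_simps)
  then show ?thesis
    using bil nondeg by (auto simp: elliptic_symplectic_def smooth_on_const)
qed


section \<open>The groupoid extending the pair groupoid\<close>

text \<open>The pair \<open>(x, a)\<close> is the point \<open>(x\<^sub>1, x\<^sub>2, a\<^sub>1, a\<^sub>2)\<close> of four-space.\<close>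

definition G_arrows :: "((real^2) \<times> (real^2)) set" where
  "G_arrows = UNIV - {(x, - (x /\<^sub>R (norm x)\<^sup>2)) | x. x \<noteq> 0}"

definition G_regular :: "((real^2) \<times> (real^2)) set" where
  "G_regular = G_arrows - {0} \<times> UNIV"

definition phi :: "(real^2) \<times> (real^2) \<Rightarrow> (real^2) \<times> (real^2)" where
  "phi = (\<lambda>(x, a). (x, (norm x)\<^sup>2 *\<^sub>R a + x))"

definition is_lie_extension :: "((real^2) \<times> (real^2), real^2) groupoid \<Rightarrow> bool" where
  "is_lie_extension H \<longleftrightarrow>
     lie_groupoid H \<and> arrows H = G_arrows \<and> objects H = UNIV \<and>
     extends_groupoid H (pullback_groupoid phi G_regular (pair_groupoid (UNIV - {0})))"

end

theory Submission
  imports Defs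
begin

text \<open>
  In the coordinates of \<open>\<G>\<close> the source of \<open>g = (x, a)\<close> is \<open>x + |x|\<^sup>2 a\<close>, and solving for the product in
  the pair groupoid gives \<open>(x, a)(y, b) = (x, a + q b)\<close> with \<open>q = |y|\<^sup>2 / |x|\<^sup>2\<close>. Since
  \<open>y = x + |x|\<^sup>2 a\<close>, this ratio is the polynomial \<open>q(x, a) = 1 + 2 x \<bullet> a + |x|\<^sup>2 |a|\<^sup>2\<close>, and the points
  removed from four-space are exactly its zeros; so all structure maps extend smoothly across
  \<open>x = 0\<close>. The extension is unique because regular arrows, and regular composable pairs, are dense.

  A section of the Lie algebroid has the form \<open>(- |x|\<^sup>2 w, w)\<close>, and its right-invariant vector field
  at \<open>(x, a)\<close> is \<open>(- |x|\<^sup>2 w, w + 2 (x \<bullet> w) a)\<close>. If \<open>\<omega> = f d log r \<and> d \<theta>\<close>, then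
  \<open>\<pi>\<^sup>\<sharp>(\<alpha>) = (|x|\<^sup>2 / f) (\<alpha>\<^sub>2, - \<alpha>\<^sub>1)\<close>, so compatibility with the anchors forces the isomorphism to send
  such a section to the one-form \<open>f (w\<^sub>2, - w\<^sub>1)\<close>; the brackets are then compared directly.
\<close>


section \<open>Smooth maps on open sets\<close>

text \<open>Functions that agree on an open set have the same derivatives there, so the claim passes
  to the derivatives by induction; hence \<open>f\<close> and \<open>g\<close> are
  generalised.\<close>

lemma Ck_on_cong:
  assumes "open S" "Ck_on k S f" "\<And>x. x \<in> S \<Longrightarrow> f x = g x"
  shows "Ck_on k S g"
  using assms(2,3)
proof (induction k arbitrary: f g)
  case 0
  then show ?case
    using continuous_on_eq[of S f g] by simp
next
  case (Suc k)
  have D: "frechet_derivative f (at x) = frechet_derivative g (at x)" if "x \<in> S" for x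
    using Suc.prems that \<open>open S\<close> by (intro frechet_derivative_transform_within_open[of f x S g]) auto
  have "(g has_derivative frechet_derivative f (at x)) (at x)" if "x \<in> S" for x
  proof (rule has_derivative_transform_within_open)
    show "(f has_derivative frechet_derivative f (at x)) (at x)"
      using Suc.prems(1) that by (simp add: frechet_derivative_works[symmetric])
  qed (use Suc.prems that \<open>open S\<close> in auto)
  moreover have "Ck_on k S (\<lambda>x. frechet_derivative g (at x) v)" for v
    by (rule Suc.IH[of "\<lambda>x. frechet_derivative f (at x) v"]) (use Suc.prems(1) D in simp_all)
  ultimately show ?case
    by (auto simp: differentiable_def)
qed

text \<open>Uniqueness of derivatives on an open set lets any explicit \<open>D\<close> stand for
  \<open>frechet_derivative\<close>. The closure rules below use this form.\<close>

lemma Ck_on_SucI: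
  assumes "open S" "\<And>x. x \<in> S \<Longrightarrow> (f has_derivative D x) (at x)" "\<And>v. Ck_on k S (\<lambda>x. D x v)"
  shows "Ck_on (Suc k) S f"
proof -
  have "D x = frechet_derivative f (at x)" if "x \<in> S" for x
    using frechet_derivative_at[OF assms(2)[OF that]] .
  then have "Ck_on k S (\<lambda>x. frechet_derivative f (at x) v)" for v
    by (intro Ck_on_cong[OF assms(1) assms(3)[of v]]) simp
  then show ?thesis
    using assms(2) by (auto simp: differentiable_def)
qed

lemma Ck_on_Suc_D: "Ck_on (Suc k) S f \<Longrightarrow> Ck_on k S f"
proof (induction k arbitrary: f)
  case 0
  then show ?case
    by (auto intro!: differentiable_imp_continuous_on differentiable_at_imp_differentiable_on)
next
  case (Suc k)
  then have "\<forall>x\<in>S. f differentiable (at x)"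
      and "\<forall>v. Ck_on (Suc k) S (\<lambda>x. frechet_derivative f (at x) v)"
    unfolding Ck_on.simps(2)[of "Suc k"] by blast+
  moreover from this have "\<forall>v. Ck_on k S (\<lambda>x. frechet_derivative f (at x) v)"
    using Suc.IH by blast
  ultimately show ?case by simp
qed

lemma Ck_on_SucE:
  assumes "Ck_on (Suc k) S f"
  shows "\<And>x. x \<in> S \<Longrightarrow> (f has_derivative frechet_derivative f (at x)) (at x)"
    and "\<And>v. Ck_on k S (\<lambda>x. frechet_derivative f (at x) v)"
  using assms by (auto simp: frechet_derivative_works[symmetric])

lemma Ck_on_const: "Ck_on k S (\<lambda>x. c)"
  by (induction k arbitrary: c) simp_all

lemma Ck_on_add:
  assumes "open S" "Ck_on k S f" "Ck_on k S g"
  shows "Ck_on k S (\<lambda>x. f x + g x)"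
  using assms(2,3)
proof (induction k arbitrary: f g)
  case 0
  then show ?case by (auto intro: continuous_on_add)
next
  case (Suc k)
  show ?case
  proof (rule Ck_on_SucI[OF \<open>open S\<close>])
    show "((\<lambda>x. f x + g x) has_derivative
        (\<lambda>v. frechet_derivative f (at x) v + frechet_derivative g (at x) v)) (at x)" if "x \<in> S" for x
      using that by (intro has_derivative_add Ck_on_SucE(1)[OF Suc.prems(1)] Ck_on_SucE(1)[OF Suc.prems(2)])
  qed (use Suc in auto)
qed

text \<open>By the Leibniz rule the derivative is a sum of two values of \<open>p\<close> at maps of
  class \<open>k\<close>. One induction thus covers scaling, inner products, real products and
  evaluation of functionals.\<close>

lemma Ck_on_bilinear:
  assumes "bounded_bilinear p" "open S" "Ck_on k S f" "Ck_on k S g"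
  shows "Ck_on k S (\<lambda>x. p (f x) (g x))"
  using assms(3,4)
proof (induction k arbitrary: f g)
  case 0
  then show ?case using bounded_bilinear.continuous_on[OF assms(1)] by auto
next
  case (Suc k)
  show ?case
  proof (rule Ck_on_SucI[OF \<open>open S\<close>])
    show "((\<lambda>x. p (f x) (g x)) has_derivative
        (\<lambda>v. p (f x) (frechet_derivative g (at x) v) + p (frechet_derivative f (at x) v) (g x))) (at x)"
      if "x \<in> S" for x
      using that by (intro bounded_bilinear.FDERIV[OF assms(1)] Ck_on_SucE(1)[OF Suc.prems(1)]
          Ck_on_SucE(1)[OF Suc.prems(2)])
    show "Ck_on k S (\<lambda>x. p (f x) (frechet_derivative g (at x) v)
        + p (frechet_derivative f (at x) v) (g x))" for v
      by (intro Ck_on_add \<open>open S\<close> Suc.IH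
          Suc.prems[THEN Ck_on_SucE(2)] Suc.prems[THEN Ck_on_Suc_D])
  qed
qed

lemmas Ck_on_scaleR = Ck_on_bilinear[OF bounded_bilinear_scaleR]
lemmas Ck_on_inner = Ck_on_bilinear[OF bounded_bilinear_inner]
lemmas Ck_on_mult = Ck_on_bilinear[OF bounded_bilinear_mult]

lemma Ck_on_linear:
  assumes "bounded_linear L" "open S" "Ck_on k S f"
  shows "Ck_on k S (\<lambda>x. L (f x))"
  using assms(3)
proof (induction k arbitrary: f)
  case 0
  then show ?case using bounded_linear.continuous_on[OF assms(1)] by auto
next
  case (Suc k)
  show ?case
  proof (rule Ck_on_SucI[OF \<open>open S\<close>])
    show "((\<lambda>x. L (f x)) has_derivative (\<lambda>v. L (frechet_derivative f (at x) v))) (at x)"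
      if "x \<in> S" for x
      using that by (intro bounded_linear.has_derivative[OF assms(1)] Ck_on_SucE(1)[OF Suc.prems(1)])
  qed (use Suc in auto)
qed

lemmas Ck_on_fst = Ck_on_linear[OF bounded_linear_fst]
lemmas Ck_on_snd = Ck_on_linear[OF bounded_linear_snd]
lemmas Ck_on_minus = Ck_on_linear[OF bounded_linear_minus[OF bounded_linear_ident]]

lemma Ck_on_Pair:
  assumes "open S" "Ck_on k S f" "Ck_on k S g"
  shows "Ck_on k S (\<lambda>x. (f x, g x))"
proof -
  have "Ck_on k S (\<lambda>x. (f x, 0) + (0, g x))"
    using assms by (intro Ck_on_add Ck_on_linear[of "\<lambda>y. (y, 0)"] Ck_on_linear[of "\<lambda>y. (0, y)"]
        bounded_linear_Pair bounded_linear_ident bounded_linear_zero)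
  then show ?thesis by simp
qed

text \<open>An inner linear map is its own derivative, so every derivative is again a map composed
  with \<open>L\<close> and the induction closes without a general chain rule. It serves to regard a
  function of the base point as a function on a bundle.\<close>

lemma Ck_on_compose_linear:
  assumes "bounded_linear L" "Ck_on k T f" "open S" "L ` S \<subseteq> T"
  shows "Ck_on k S (\<lambda>x. f (L x))"
  using assms(2)
proof (induction k arbitrary: f)
  case 0
  then show ?case
    using assms(4) by (auto intro!: continuous_on_compose2[of T f S L]
        linear_continuous_on[OF assms(1)])
next
  case (Suc k)
  show ?case
  proof (rule Ck_on_SucI[OF \<open>open S\<close>])
    show "((\<lambda>x. f (L x)) has_derivative (\<lambda>v. frechet_derivative f (at (L x)) (L v))) (at x)"
      if "x \<in> S" for x
      using that assms(4) has_derivative_compose[OF bounded_linear_imp_has_derivative[OF assms(1)]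
          Ck_on_SucE(1)[OF Suc.prems]] by blast
  qed (use Suc in auto)
qed

lemma Ck_on_ident: "open S \<Longrightarrow> Ck_on k S (\<lambda>x. x)"
proof (cases k)
  case (Suc n)
  assume "open S"
  then show ?thesis
    unfolding Suc by (intro Ck_on_SucI[of S _ "\<lambda>_ v. v"] Ck_on_const) auto
qed (simp add: continuous_on_id)

text \<open>The derivative of \<open>inverse f\<close> is a product of \<open>inverse f\<close>,
  twice, with the derivative of \<open>f\<close>; the induction hypothesis and the product rule
  apply.\<close>

lemma Ck_on_inverse:
  fixes f :: "'a::real_normed_vector \<Rightarrow> real"
  assumes "open S" "Ck_on k S f" "\<And>x. x \<in> S \<Longrightarrow> f x \<noteq> 0"
  shows "Ck_on k S (\<lambda>x. inverse (f x))"
  using assms(2)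
proof (induction k)
  case 0
  then show ?case using assms(3) by (auto intro!: continuous_on_inverse)
next
  case (Suc k)
  show ?case
  proof (rule Ck_on_SucI[OF \<open>open S\<close>])
    show "((\<lambda>x. inverse (f x)) has_derivative
        (\<lambda>v. - (inverse (f x) * frechet_derivative f (at x) v * inverse (f x)))) (at x)"
      if "x \<in> S" for x
      using that assms(3) by (intro Deriv.has_derivative_inverse Ck_on_SucE(1)[OF Suc.prems])
    show "Ck_on k S (\<lambda>x. - (inverse (f x) * frechet_derivative f (at x) v * inverse (f x)))" for v
      by (intro Ck_on_minus Ck_on_mult \<open>open S\<close> Suc.IH
          Suc.prems[THEN Ck_on_SucE(2)] Suc.prems[THEN Ck_on_Suc_D])
  qed
qed

lemmas Ck_on_intros = Ck_on_const Ck_on_ident Ck_on_add Ck_on_minus Ck_on_scaleR Ck_on_inner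
  Ck_on_mult Ck_on_fst Ck_on_snd Ck_on_Pair Ck_on_inverse

lemma smooth_onI:
  assumes "open U" "A \<subseteq> U" "\<And>k. Ck_on k U g" "\<And>x. x \<in> A \<Longrightarrow> g x = f x"
  shows "smooth_on A f"
  unfolding smooth_on_def using assms by blast

lemma smooth_on_imp_continuous_on:
  assumes "smooth_on A f"
  shows "continuous_on A f"
  unfolding continuous_on_eq_continuous_within
proof
  fix x assume "x \<in> A"
  then obtain U g where U: "open U" "x \<in> U" "\<forall>k. Ck_on k U g" "\<forall>y\<in>U \<inter> A. g y = f y"
    using assms unfolding smooth_on_def by blast
  have "continuous_on U g" using U(3) Ck_on.simps(1) by blast
  then have "continuous (at x within A) g"
    using U by (simp add: continuous_on_eq_continuous_at continuous_at_imp_continuous_at_within)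
  moreover have "\<forall>\<^sub>F y in at x within A. g y = f y"
    using U unfolding eventually_at_topological by blast
  ultimately show "continuous (at x within A) f"
    using U(2,4) \<open>x \<in> A\<close> by (auto simp: continuous_within intro: Lim_transform_eventually)
qed

lemma smooth_on_UNIV_imp_Ck_on:
  assumes "smooth_on UNIV f"
  shows "Ck_on k UNIV f"
proof -
  \<comment> \<open>Being of class \<open>k\<close> is a local property: continuity and
    differentiability are tested at single points, and the derivatives inherit the local
    hypothesis.\<close>
  have loc: "Ck_on k UNIV f" if "\<And>x. \<exists>U. open U \<and> x \<in> U \<and> Ck_on k U f" for f :: "'a \<Rightarrow> 'b"
    using that
  proof (induction k arbitrary: f)
    case 0
    have "isCont f x" for x
      using 0[of x] by (auto simp: continuous_on_eq_continuous_at)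
    then show ?case
      by (simp add: continuous_on_eq_continuous_at)
  next
    case (Suc k)
    have "f differentiable (at x)" for x
      using Suc.prems[of x] by auto
    moreover have "Ck_on k UNIV (\<lambda>x. frechet_derivative f (at x) v)" for v
    proof (rule Suc.IH)
      show "\<exists>U. open U \<and> x \<in> U \<and> Ck_on k U (\<lambda>x. frechet_derivative f (at x) v)" for x
        using Suc.prems[of x] by auto
    qed
    ultimately show ?case by simp
  qed
  show ?thesis
  proof (rule loc)
    fix x
    obtain U g where U: "open U" "x \<in> U" "\<forall>k. Ck_on k U g" "\<forall>y\<in>U. g y = f y"
      using assms unfolding smooth_on_def by (metis Int_UNIV_right UNIV_I)
    then show "\<exists>U. open U \<and> x \<in> U \<and> Ck_on k U f"
      using Ck_on_cong[of U k g f] by blast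
  qed
qed


section \<open>The structure maps in coordinates\<close>

text \<open>This is the ratio q of the overview. For x nonzero it equals the square of the norm of
  x/|x| + |x| a, so it vanishes only at a = -x/|x|^2.\<close>

definition dilation :: "(real^2) \<times> (real^2) \<Rightarrow> real" where
  "dilation g = 1 + 2 * (fst g \<bullet> snd g) + (fst g \<bullet> fst g) * (snd g \<bullet> snd g)"

definition G_src :: "(real^2) \<times> (real^2) \<Rightarrow> real^2" where
  "G_src g = fst g + (fst g \<bullet> fst g) *\<^sub>R snd g"

definition G_mult :: "(real^2) \<times> (real^2) \<Rightarrow> (real^2) \<times> (real^2) \<Rightarrow> (real^2) \<times> (real^2)" where
  "G_mult g h = (fst g, snd g + dilation g *\<^sub>R snd h)"

text \<open>The inverse has base point y = x + |x|^2 a. Solving y + |y|^2 a' = x with |y|^2 = |x|^2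
  q gives a' = -a/q.\<close>

definition G_inv :: "(real^2) \<times> (real^2) \<Rightarrow> (real^2) \<times> (real^2)" where
  "G_inv g = (G_src g, - (inverse (dilation g) *\<^sub>R snd g))"

definition G_groupoid :: "((real^2) \<times> (real^2), real^2) groupoid" where
  "G_groupoid =
     \<lparr>arrows = G_arrows, objects = UNIV, src = restrict G_src G_arrows, tgt = restrict fst G_arrows,
      mult = (\<lambda>(g, h)\<in>{(g, h). g \<in> G_arrows \<and> h \<in> G_arrows \<and> G_src g = fst h}. G_mult g h),
      unit_at = (\<lambda>x. (x, 0)), inverse_of = restrict G_inv G_arrows\<rparr>"

section \<open>Algebraic identities behind the groupoid axioms\<close>

text \<open>Expanding the square of x + |x|^2 a produces a common factor |x|^2. The groupoid
  identities below rest on this relation.\<close>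

lemma inner_G_src: "G_src g \<bullet> G_src g = (fst g \<bullet> fst g) * dilation g"
  by (simp add: G_src_def dilation_def inner_add_left inner_add_right inner_commute algebra_simps)

lemma dilation_eq_1: "fst g = 0 \<Longrightarrow> dilation g = 1"
  by (simp add: dilation_def)

text \<open>If q vanishes, then x is nonzero because q = 1 over the origin, and |x + |x|^2 a|^2 =
  |x|^2 q = 0 can be solved for a, which gives a removed point. Conversely q vanishes at the removed
  points by substitution.\<close>

lemma mem_G_arrows: "g \<in> G_arrows \<longleftrightarrow> dilation g \<noteq> 0"
proof
  assume g: "g \<in> G_arrows"
  show "dilation g \<noteq> 0"
  proof
    assume 0: "dilation g = 0"
    then have x: "fst g \<noteq> 0"
      using dilation_eq_1[of g] by auto
    have "fst g + (fst g \<bullet> fst g) *\<^sub>R snd g = 0"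
      using inner_G_src[of g] 0 by (simp add: G_src_def)
    then have "fst g = - ((fst g \<bullet> fst g) *\<^sub>R snd g)"
      by (simp add: eq_neg_iff_add_eq_0)
    then have "inverse (fst g \<bullet> fst g) *\<^sub>R fst g = inverse (fst g \<bullet> fst g) *\<^sub>R - ((fst g \<bullet> fst g) *\<^sub>R snd g)"
      by (rule arg_cong)
    then have "snd g = - (fst g /\<^sub>R (norm (fst g))\<^sup>2)"
      using x by (simp add: power2_norm_eq_inner)
    then have "g = (fst g, - (fst g /\<^sub>R (norm (fst g))\<^sup>2))"
      by (simp add: prod_eq_iff)
    then show False
      using g x unfolding G_arrows_def by blast
  qed
next
  assume "dilation g \<noteq> 0"
  moreover have "dilation (x, - (x /\<^sub>R (norm x)\<^sup>2)) = 0" if "x \<noteq> 0" for x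
    using that by (simp add: dilation_def power2_norm_eq_inner)
  ultimately show "g \<in> G_arrows"
    unfolding G_arrows_def by blast
qed

lemma mem_G_regular: "g \<in> G_regular \<longleftrightarrow> dilation g \<noteq> 0 \<and> fst g \<noteq> 0"
  by (cases g) (auto simp: G_regular_def mem_G_arrows)

text \<open>The divisor is invariant: an arrow ends at the origin exactly when it starts there,
  because the squared norms of its endpoints differ by the nonzero factor q.\<close>

lemma G_src_eq_0: "dilation g \<noteq> 0 \<Longrightarrow> G_src g = 0 \<longleftrightarrow> fst g = 0"
  using inner_G_src[of g] by (metis inner_eq_zero_iff mult_eq_0_iff)

lemma G_src_unit: "G_src (x, 0) = x" and dilation_unit: "dilation (x, 0) = 1"
  by (simp_all add: G_src_def dilation_def)

lemma fst_G_mult: "fst (G_mult g h) = fst g"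
  by (simp add: G_mult_def)

text \<open>With y the source of \<open>g\<close>, the relation |x|^2 q = |y|^2 turns x + |x|^2 (a +
  q b) into y + |y|^2 b.\<close>

lemma G_src_mult: "G_src g = fst h \<Longrightarrow> G_src (G_mult g h) = G_src h"
  using inner_G_src[of g] by (simp add: G_src_def G_mult_def scaleR_add_right)

text \<open>Off the divisor, \<open>dilation g\<close> is \<open>|G_src g|\<^sup>2 / |fst g|\<^sup>2\<close>, so it is multiplicative.\<close>

lemma dilation_mult:
  assumes "G_src g = fst h"
  shows "dilation (G_mult g h) = dilation g * dilation h"
proof (cases "fst g = 0")
  case True
  then have "fst h = 0" using assms by (simp add: G_src_def)
  then show ?thesis using True by (simp add: dilation_eq_1 fst_G_mult)
next
  case False
  \<comment> \<open>Both sides are the squared norm of \<open>G_src h\<close>; the factor |x|^2 is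
    then cancelled.\<close>
  have "(fst g \<bullet> fst g) * dilation (G_mult g h) = (fst g \<bullet> fst g) * (dilation g * dilation h)"
    using inner_G_src[of "G_mult g h"] inner_G_src[of g] inner_G_src[of h]
    by (auto simp: G_src_mult[OF assms] fst_G_mult assms)
  then show ?thesis using False by simp
qed

text \<open>Since |y|^2 / q = |x|^2, the source of the inverse is y - |x|^2 a = x.\<close>

lemma G_src_inv:
  assumes "dilation g \<noteq> 0"
  shows "G_src (G_inv g) = fst g"
proof -
  have "G_src (G_inv g) = G_src g - (fst g \<bullet> fst g) *\<^sub>R snd g"
    using assms inner_G_src[of g] by (simp add: G_src_def[of "(a, b)" for a b] G_inv_def)
  then show ?thesis by (simp add: G_src_def)
qed

lemma fst_G_inv: "fst (G_inv g) = G_src g"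
  by (simp add: G_inv_def)

text \<open>Applying \<open>inner_G_src\<close> to \<open>g\<close> and to its inverse gives |x|^2
  q(g) q(g^-1) = |x|^2. Over the origin both values are 1.\<close>

lemma dilation_inv:
  assumes "dilation g \<noteq> 0"
  shows "dilation (G_inv g) = inverse (dilation g)"
proof (cases "fst g = 0")
  case True
  then show ?thesis using G_src_eq_0[OF assms] by (simp add: dilation_eq_1 fst_G_inv)
next
  case False
  have "(fst g \<bullet> fst g) * (dilation g * dilation (G_inv g)) = fst g \<bullet> fst g"
    using inner_G_src[of "G_inv g"] by (simp add: G_src_inv[OF assms] fst_G_inv inner_G_src)
  then show ?thesis using False assms by (simp add: field_simps)
qed

text \<open>Both products have second component a + q(g) b + q(g) q(h) c; associativity is the
  multiplicativity of q.\<close>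

lemma G_mult_assoc: "G_src g = fst h \<Longrightarrow> G_mult (G_mult g h) k = G_mult g (G_mult h k)"
  by (simp add: G_mult_def[of "G_mult g h"] dilation_mult) (simp add: G_mult_def scaleR_add_right)

lemma G_mult_unit: "G_mult (fst g, 0) g = g" "G_mult g (x, 0) = g"
  by (simp_all add: G_mult_def dilation_unit)

lemma G_mult_inv:
  assumes "dilation g \<noteq> 0"
  shows "G_mult g (G_inv g) = (fst g, 0)" "G_mult (G_inv g) g = (G_src g, 0)"
  using assms by (simp_all add: G_mult_def dilation_inv) (simp_all add: G_inv_def)

lemma composable_G_groupoid:
  "composable G_groupoid = {(g, h). g \<in> G_arrows \<and> h \<in> G_arrows \<and> G_src g = fst h}"
  by (auto simp: composable_def G_groupoid_def)

lemma is_groupoid_G_groupoid: "is_groupoid G_groupoid"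
  unfolding is_groupoid_def composable_G_groupoid
  unfolding G_groupoid_def
  by (auto simp: mem_G_arrows dilation_mult G_src_mult fst_G_mult G_mult_assoc G_src_unit
      dilation_unit dilation_inv G_src_inv fst_G_inv G_mult_unit G_mult_inv)

section \<open>Smoothness and the submersion property\<close>

lemma open_G_arrows: "open G_arrows"
proof -
  have "continuous_on UNIV dilation"
    unfolding dilation_def[abs_def] by (intro continuous_intros)
  then have "open {g. dilation g \<noteq> 0}"
    by (intro open_Collect_neq continuous_on_const)
  then show ?thesis
    by (simp add: mem_G_arrows[symmetric])
qed

lemma Ck_on_dilation: "open S \<Longrightarrow> Ck_on k S f \<Longrightarrow> Ck_on k S (\<lambda>x. dilation (f x))"
  unfolding dilation_def by (intro Ck_on_intros)

lemma Ck_on_G_src: "open S \<Longrightarrow> Ck_on k S f \<Longrightarrow> Ck_on k S (\<lambda>x. G_src (f x))"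
  unfolding G_src_def by (intro Ck_on_intros)

lemma has_derivative_G_src:
  "(G_src has_derivative (\<lambda>v. fst v + (2 * (fst g \<bullet> fst v)) *\<^sub>R snd g + (fst g \<bullet> fst g) *\<^sub>R snd v)) (at g)"
  unfolding G_src_def[abs_def]
  by (auto intro!: derivative_eq_intros simp: inner_commute)

lemma G_groupoid_simps [simp]:
  "arrows G_groupoid = G_arrows" "objects G_groupoid = UNIV" "unit_at G_groupoid x = (x, 0)"
  "g \<in> G_arrows \<Longrightarrow> src G_groupoid g = G_src g"
  "g \<in> G_arrows \<Longrightarrow> tgt G_groupoid g = fst g"
  "g \<in> G_arrows \<Longrightarrow> inverse_of G_groupoid g = G_inv g"
  by (simp_all add: G_groupoid_def)

lemma mult_G_groupoid:
  "p \<in> composable G_groupoid \<Longrightarrow> mult G_groupoid p = G_mult (fst p) (snd p)"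
  unfolding composable_G_groupoid by (auto simp: G_groupoid_def)

lemma frechet_derivative_src_G_groupoid:
  assumes "g \<in> G_arrows"
  shows "frechet_derivative (src G_groupoid) (at g) =
    (\<lambda>v. fst v + (2 * (fst g \<bullet> fst v)) *\<^sub>R snd g + (fst g \<bullet> fst g) *\<^sub>R snd v)"
  by (rule frechet_derivative_at[symmetric],
      rule has_derivative_transform_within_open[OF has_derivative_G_src open_G_arrows assms]) simp

lemma frechet_derivative_tgt_G_groupoid:
  assumes "g \<in> G_arrows"
  shows "frechet_derivative (tgt G_groupoid) (at g) = fst"
  by (rule frechet_derivative_at[symmetric],
      rule has_derivative_transform_within_open[OF
        bounded_linear_imp_has_derivative[OF bounded_linear_fst] open_G_arrows assms]) simp

text \<open>Over the origin the derivative is the first projection. Elsewhere its restriction to the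
  second factor is already |x|^2 times the identity.\<close>

lemma surj_src_G_groupoid:
  assumes "g \<in> G_arrows"
  shows "surj (frechet_derivative (src G_groupoid) (at g))"
proof -
  have "\<exists>v. y = fst v + (2 * (fst g \<bullet> fst v)) *\<^sub>R snd g + (fst g \<bullet> fst g) *\<^sub>R snd v" for y
  proof (cases "fst g = 0")
    case True
    then show ?thesis by (intro exI[of _ "(y, 0)"]) simp
  next
    case False
    then show ?thesis by (intro exI[of _ "(0, inverse (fst g \<bullet> fst g) *\<^sub>R y)"]) simp
  qed
  then show ?thesis
    by (auto simp: surj_def frechet_derivative_src_G_groupoid[OF assms])
qed

lemma surj_fst: "surj fst"
  by (metis fst_conv surj_def)

lemma lie_groupoid_G_groupoid: "lie_groupoid G_groupoid"
  unfolding lie_groupoid_def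
proof (intro conjI ballI)
  show "smooth_on (arrows G_groupoid) (src G_groupoid)"
    by (rule smooth_onI[of UNIV _ G_src])
      (simp_all add: Ck_on_G_src[OF open_UNIV Ck_on_ident[OF open_UNIV]])
  show "smooth_on (arrows G_groupoid) (tgt G_groupoid)"
    by (rule smooth_onI[of UNIV _ fst])
      (simp_all add: Ck_on_fst[OF open_UNIV Ck_on_ident[OF open_UNIV]])
  show "smooth_on (composable G_groupoid) (mult G_groupoid)"
  proof (rule smooth_onI)
    show "Ck_on k UNIV (\<lambda>p. G_mult (fst p) (snd p))" for k
      unfolding G_mult_def by (intro Ck_on_intros Ck_on_dilation open_UNIV)
  qed (simp_all add: mult_G_groupoid)
  show "smooth_on (objects G_groupoid) (unit_at G_groupoid)"
    by (rule smooth_onI[of UNIV _ "\<lambda>x. (x, 0)"]) (auto intro!: Ck_on_intros)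
  show "smooth_on (arrows G_groupoid) (inverse_of G_groupoid)"
  proof (rule smooth_onI)
    show "Ck_on k G_arrows G_inv" for k
      unfolding G_inv_def[abs_def]
      by (intro Ck_on_intros Ck_on_dilation Ck_on_G_src open_G_arrows) (simp add: mem_G_arrows)
  qed (simp_all add: open_G_arrows)
qed (simp_all add: is_groupoid_G_groupoid open_G_arrows surj_src_G_groupoid
    frechet_derivative_tgt_G_groupoid surj_fst)

section \<open>The diffeomorphism onto the pair groupoid\<close>

lemma phi_eq: "phi g = (fst g, G_src g)"
  by (cases g) (simp add: phi_def G_src_def power2_norm_eq_inner add.commute)

text \<open>The equation y = x + |x|^2 a solved for a. The difference is written as a sum with a
  negative to match the available smoothness rules.\<close>

definition phi_inv :: "(real^2) \<times> (real^2) \<Rightarrow> (real^2) \<times> (real^2)" where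
  "phi_inv p = (fst p, inverse (fst p \<bullet> fst p) *\<^sub>R (snd p + - fst p))"

lemma phi_phi_inv: "fst p \<noteq> 0 \<Longrightarrow> phi (phi_inv p) = p"
  by (simp add: phi_eq phi_inv_def G_src_def prod_eq_iff)

lemma phi_inv_phi: "fst g \<noteq> 0 \<Longrightarrow> phi_inv (phi g) = g"
  by (simp add: phi_eq phi_inv_def G_src_def prod_eq_iff)

text \<open>The relation |x|^2 q = |y|^2 with y nonzero forces q to be nonzero.\<close>

lemma phi_inv_mem: "p \<in> (UNIV - {0}) \<times> (UNIV - {0}) \<Longrightarrow> phi_inv p \<in> G_regular"
  using phi_phi_inv[of p] inner_G_src[of "phi_inv p"]
  by (auto simp: mem_G_regular phi_eq prod_eq_iff)

lemma bij_betw_phi: "bij_betw phi G_regular ((UNIV - {0}) \<times> (UNIV - {0}))"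
proof (rule bij_betwI[where g = phi_inv])
  show "phi \<in> G_regular \<rightarrow> (UNIV - {0}) \<times> (UNIV - {0})"
    by (auto simp: mem_G_regular phi_eq G_src_eq_0)
  show "phi_inv \<in> (UNIV - {0}) \<times> (UNIV - {0}) \<rightarrow> G_regular"
    using phi_inv_mem by blast
qed (auto simp: mem_G_regular phi_inv_phi phi_phi_inv)

lemma inv_into_phi: "g \<in> G_regular \<Longrightarrow> phi g = p \<Longrightarrow> inv_into G_regular phi p = g"
  using bij_betw_phi by (simp add: bij_betw_def inv_into_f_eq)

lemma diffeomorphism_on_phi: "diffeomorphism_on phi G_regular ((UNIV - {0}) \<times> (UNIV - {0}))"
  unfolding diffeomorphism_on_def
proof (intro conjI bij_betw_phi)
  show "smooth_on G_regular phi"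
    by (rule smooth_onI[of UNIV _ phi])
      (auto simp: phi_eq[abs_def] intro!: Ck_on_intros Ck_on_G_src)
  have op: "open ((UNIV - {0 :: real^2}) \<times> (UNIV - {0 :: real^2}))"
    by (intro open_Times open_Diff) auto
  show "smooth_on ((UNIV - {0}) \<times> (UNIV - {0})) (inv_into G_regular phi)"
  proof (rule smooth_onI[OF op order_refl])
    show "Ck_on k ((UNIV - {0}) \<times> (UNIV - {0})) phi_inv" for k
      unfolding phi_inv_def[abs_def] by (intro Ck_on_intros op) auto
    show "phi_inv p = inv_into G_regular phi p" if "p \<in> (UNIV - {0}) \<times> (UNIV - {0})" for p
      using that by (intro inv_into_phi[symmetric] phi_inv_mem phi_phi_inv) auto
  qed
qed


section \<open>The unique extension of the pair groupoid\<close>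

abbreviation regular_groupoid :: "((real^2) \<times> (real^2), real^2) groupoid" where
  "regular_groupoid \<equiv> pullback_groupoid phi G_regular (pair_groupoid (UNIV - {0}))"

text \<open>The transported structure maps become the explicit coordinate formulas. For inverses and
  units it suffices to check the image under \<open>phi\<close>, which is injective on
  \<open>G_regular\<close>.\<close>

lemma regular_groupoid_simps:
  "arrows regular_groupoid = G_regular" "objects regular_groupoid = UNIV - {0}"
  "g \<in> G_regular \<Longrightarrow> src regular_groupoid g = G_src g"
  "g \<in> G_regular \<Longrightarrow> tgt regular_groupoid g = fst g"
  "g \<in> G_regular \<Longrightarrow> inverse_of regular_groupoid g = G_inv g"
  "x \<noteq> 0 \<Longrightarrow> unit_at regular_groupoid x = (x, 0)"
proof -
  assume g: "g \<in> G_regular"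
  then have mem: "phi g \<in> (UNIV - {0}) \<times> (UNIV - {0})"
    using bij_betw_phi by (auto simp: bij_betw_def)
  show "src regular_groupoid g = G_src g" "tgt regular_groupoid g = fst g"
    using g mem by (simp_all add: pullback_groupoid_def pair_groupoid_def phi_eq)
  have "inv_into G_regular phi (G_src g, fst g) = G_inv g"
    using g by (intro inv_into_phi)
      (auto simp: mem_G_regular phi_eq dilation_inv fst_G_inv G_src_inv G_src_eq_0)
  then show "inverse_of regular_groupoid g = G_inv g"
    using g mem by (simp add: pullback_groupoid_def pair_groupoid_def phi_eq)
next
  assume "x \<noteq> 0"
  then show "unit_at regular_groupoid x = (x, 0)"
    by (simp add: pullback_groupoid_def pair_groupoid_def)
      (intro inv_into_phi; simp add: mem_G_regular dilation_unit phi_eq G_src_unit)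
qed (simp_all add: pullback_groupoid_def pair_groupoid_def)

lemma composable_regular_groupoid:
  "composable regular_groupoid = {(g, h). g \<in> G_regular \<and> h \<in> G_regular \<and> G_src g = fst h}"
  by (auto simp: composable_def regular_groupoid_simps)

lemma mult_regular_groupoid:
  assumes "g \<in> G_regular" "h \<in> G_regular" "G_src g = fst h"
  shows "mult regular_groupoid (g, h) = G_mult g h"
proof -
  have "phi g \<in> (UNIV - {0}) \<times> (UNIV - {0})" "phi h \<in> (UNIV - {0}) \<times> (UNIV - {0})"
    using assms bij_betw_phi by (auto simp: bij_betw_def)
  then have "mult regular_groupoid (g, h) = inv_into G_regular phi (fst g, G_src h)"
    using assms by (simp add: pullback_groupoid_def pair_groupoid_def phi_eq)
  also have "\<dots> = G_mult g h"
    using assms by (intro inv_into_phi)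
      (auto simp: mem_G_regular phi_eq dilation_mult fst_G_mult G_src_mult)
  finally show ?thesis .
qed

lemma G_regular_subset: "g \<in> G_regular \<Longrightarrow> g \<in> G_arrows"
  by (simp add: G_regular_def)

lemma is_lie_extension_G_groupoid: "is_lie_extension G_groupoid"
  unfolding is_lie_extension_def extends_groupoid_def
  by (auto simp: lie_groupoid_G_groupoid regular_groupoid_simps composable_regular_groupoid
      mult_regular_groupoid mult_G_groupoid composable_G_groupoid G_regular_subset)

section \<open>Density of the regular arrows and composable pairs\<close>

lemma continuous_on_agree_at_limit:
  fixes \<gamma> :: "real \<Rightarrow> 'a::topological_space" and F F' :: "'a \<Rightarrow> 'b::t2_space"
  assumes "continuous_on A F" "continuous_on A F'" "p \<in> A" "(\<gamma> \<longlongrightarrow> p) (at_right 0)"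
    and ev: "\<forall>\<^sub>F t in at_right 0. \<gamma> t \<in> A \<and> F (\<gamma> t) = F' (\<gamma> t)"
  shows "F p = F' p"
proof -
  have mem: "\<forall>\<^sub>F t in at_right 0. \<gamma> t \<in> A"
    using ev by eventually_elim simp
  have lim: "((\<lambda>t. F (\<gamma> t)) \<longlongrightarrow> F p) (at_right 0)" "((\<lambda>t. F' (\<gamma> t)) \<longlongrightarrow> F' p) (at_right 0)"
    using continuous_on_tendsto_compose[OF _ assms(4,3) mem] assms(1,2) by blast+
  have "((\<lambda>t. F (\<gamma> t)) \<longlongrightarrow> F' p) (at_right 0)"
    using ev by (intro Lim_transform_eventually[OF lim(2)]) (auto elim: eventually_mono)
  then show ?thesis
    using lim(1) tendsto_unique trivial_limit_at_right_real by blast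
qed

lemma eventually_regular_curve:
  fixes \<gamma> :: "real \<Rightarrow> (real^2) \<times> (real^2)"
  assumes "(\<gamma> \<longlongrightarrow> g) (at_right 0)" "g \<in> G_arrows" "\<And>t. t > 0 \<Longrightarrow> dilation (\<gamma> t) \<noteq> 0 \<Longrightarrow> fst (\<gamma> t) \<noteq> 0"
  shows "\<forall>\<^sub>F t in at_right 0. \<gamma> t \<in> G_regular"
proof -
  have "\<forall>\<^sub>F t in at_right 0. \<gamma> t \<in> G_arrows"
    using topological_tendstoD[OF assms(1) open_G_arrows assms(2)] .
  moreover have "\<forall>\<^sub>F t in at_right (0::real). t > 0"
    by (simp add: eventually_at_right_less)
  ultimately show ?thesis
    by eventually_elim (simp add: mem_G_regular mem_G_arrows assms(3))
qed

lemma tendsto_scaleR_at_right_0: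
  fixes v :: "'a::real_normed_vector"
  shows "((\<lambda>t. t *\<^sub>R v) \<longlongrightarrow> 0) (at_right 0)"
  using tendsto_scaleR[OF tendsto_ident_at[of 0 "{0<..}"] tendsto_const[of v]] by simp

lemma tendsto_base_curve:
  fixes a :: "real^2"
  shows "((\<lambda>t. (t *\<^sub>R axis 1 1 :: real^2, a)) \<longlongrightarrow> (0, a)) (at_right 0)"
  by (intro tendsto_Pair tendsto_scaleR_at_right_0 tendsto_const)

text \<open>The second leg of a curve of composable pairs: its base point follows the source of the
  first leg \<open>(t *\<^sub>R axis 1 1, a)\<close>.\<close>

lemma tendsto_src_curve:
  fixes a b :: "real^2"
  shows "((\<lambda>t. (G_src (t *\<^sub>R axis 1 1, a), b)) \<longlongrightarrow> (0, b)) (at_right 0)"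
proof -
  have "((\<lambda>t. G_src (t *\<^sub>R axis 1 1, a)) \<longlongrightarrow> 0 + (0 \<bullet> (0 :: real^2)) *\<^sub>R a) (at_right 0)"
    unfolding G_src_def fst_conv snd_conv
    by (intro tendsto_add tendsto_scaleR tendsto_inner tendsto_scaleR_at_right_0 tendsto_const)
  then show ?thesis
    by (intro tendsto_Pair tendsto_const) simp
qed

lemma axis_1_nonzero: "(axis 1 1 :: real^2) \<noteq> 0"
  by (simp add: axis_eq_0_iff)

lemma base_curve_regular: "\<forall>\<^sub>F t in at_right 0. (t *\<^sub>R axis 1 1, a) \<in> G_regular"
  by (rule eventually_regular_curve[OF tendsto_base_curve])
    (simp_all add: mem_G_arrows dilation_eq_1 axis_1_nonzero)

text \<open>An arrow that is not regular has the form (0, a) and is the limit of the regular arrows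
  \<open>(t *\<^sub>R axis 1 1, a)\<close> as t decreases to 0.\<close>

lemma continuous_on_G_arrows_unique:
  fixes F F' :: "(real^2) \<times> (real^2) \<Rightarrow> 'b::t2_space"
  assumes "continuous_on G_arrows F" "continuous_on G_arrows F'"
    and eq: "\<And>g. g \<in> G_regular \<Longrightarrow> F g = F' g" and g: "g \<in> G_arrows"
  shows "F g = F' g"
proof (cases "g \<in> G_regular")
  case False
  then obtain a where a: "g = (0, a)"
    using g by (cases g) (simp add: mem_G_regular mem_G_arrows)
  have lim: "((\<lambda>t. (t *\<^sub>R axis 1 1, a)) \<longlongrightarrow> g) (at_right 0)"
    unfolding a by (rule tendsto_base_curve)
  show ?thesis
    by (rule continuous_on_agree_at_limit[OF assms(1,2) g lim])
      (use base_curve_regular[of a] in \<open>eventually_elim; simp add: eq G_regular_subset\<close>)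
qed (use eq in simp)

lemma lie_extension_eq_G_groupoid:
  assumes "is_lie_extension H"
  shows "H = G_groupoid"
proof -
  have H: "is_groupoid H" "smooth_on (arrows H) (src H)" "smooth_on (arrows H) (tgt H)"
      "smooth_on (composable H) (mult H)" "smooth_on (objects H) (unit_at H)"
      "smooth_on (arrows H) (inverse_of H)"
    and sets: "arrows H = G_arrows" "objects H = UNIV"
    and ext: "extends_groupoid H regular_groupoid"
    using assms by (auto simp: is_lie_extension_def lie_groupoid_def)
  have G: "smooth_on (arrows G_groupoid) (src G_groupoid)" "smooth_on (arrows G_groupoid) (tgt G_groupoid)"
      "smooth_on (composable G_groupoid) (mult G_groupoid)" "smooth_on (objects G_groupoid) (unit_at G_groupoid)"
      "smooth_on (arrows G_groupoid) (inverse_of G_groupoid)"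
    using lie_groupoid_G_groupoid by (auto simp: lie_groupoid_def)
  \<comment> \<open>Items 1 to 5 concern the source, target, product, unit and inverse of
    \<open>H\<close>, in this order; items 6 to 10 concern those of
    \<open>G_groupoid\<close>.\<close>
  note cont = H(2-6)[THEN smooth_on_imp_continuous_on, unfolded sets]
    G[THEN smooth_on_imp_continuous_on, unfolded G_groupoid_simps(1,2)]
  have reg: "src H g = G_src g" "tgt H g = fst g" "inverse_of H g = G_inv g" if "g \<in> G_regular" for g
    using ext that by (simp_all add: extends_groupoid_def regular_groupoid_simps)
  have ar: "src H g = src G_groupoid g" "tgt H g = tgt G_groupoid g"
      "inverse_of H g = inverse_of G_groupoid g" if "g \<in> G_arrows" for g
    by (rule continuous_on_G_arrows_unique[OF _ _ _ that], rule cont, rule cont,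
        simp add: reg G_regular_subset)+
  \<comment> \<open>Composability depends only on source and target, which are now identified, so
    the two products are continuous on the same set.\<close>
  have comp: "composable H = composable G_groupoid"
    by (auto simp: composable_def sets ar)
  \<comment> \<open>Extensionality upgrades agreement on the domains to equality of the functions,
    as equality of records requires.\<close>
  have E: "src H \<in> extensional G_arrows" "tgt H \<in> extensional G_arrows"
      "inverse_of H \<in> extensional G_arrows" "mult H \<in> extensional (composable G_groupoid)"
    using H(1) by (auto simp: is_groupoid_def sets comp PiE_def)
  have E': "src G_groupoid \<in> extensional G_arrows" "tgt G_groupoid \<in> extensional G_arrows"
      "inverse_of G_groupoid \<in> extensional G_arrows" "mult G_groupoid \<in> extensional (composable G_groupoid)"
    using is_groupoid_G_groupoid by (auto simp: is_groupoid_def PiE_def)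
  have "src H = src G_groupoid" "tgt H = tgt G_groupoid" "inverse_of H = inverse_of G_groupoid"
    using E(1-3) E'(1-3) ar by (auto intro: extensionalityI)
  moreover have "mult H = mult G_groupoid"
  proof (rule extensionalityI[OF E(4) E'(4)])
    fix p assume p: "p \<in> composable G_groupoid"
    have reg: "mult H (g, h) = mult G_groupoid (g, h)"
      if "g \<in> G_regular" "h \<in> G_regular" "G_src g = fst h" for g h
    proof -
      have "(g, h) \<in> composable regular_groupoid"
        using that by (simp add: composable_regular_groupoid)
      then have "mult H (g, h) = mult regular_groupoid (g, h)"
        using ext unfolding extends_groupoid_def by blast
      then show ?thesis
        using that by (simp add: mult_regular_groupoid mult_G_groupoid composable_G_groupoid
            G_regular_subset)
    qed
    obtain g h where gh: "p = (g, h)" "g \<in> G_arrows" "h \<in> G_arrows" "G_src g = fst h"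
      using p by (auto simp: composable_G_groupoid)
    show "mult H p = mult G_groupoid p"
    proof (cases "g \<in> G_regular")
      case True
      then show ?thesis
        using gh G_src_eq_0[of g] by (auto simp: mem_G_regular mem_G_arrows intro!: reg)
    next
      case False
      then obtain a b where ab: "g = (0, a)" "h = (0, b)"
        using gh G_src_eq_0[of g] by (cases g; cases h) (simp add: mem_G_regular mem_G_arrows)
      \<comment> \<open>A composable pair over the origin is approached by regular ones: the first
        base point moves along an axis, the second is adjusted to stay composable, and a and b
        remain fixed.\<close>
      let ?g = "\<lambda>t. (t *\<^sub>R axis 1 1 :: real^2, a)" and ?h = "\<lambda>t. (G_src (t *\<^sub>R axis 1 1, a), b)"
      have lim: "((\<lambda>t. (?g t, ?h t)) \<longlongrightarrow> p) (at_right 0)"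
        unfolding gh(1) ab by (intro tendsto_Pair[OF tendsto_base_curve tendsto_src_curve])
      have "\<forall>\<^sub>F t in at_right 0. ?h t \<in> G_regular"
      proof -
        have "(?h \<longlongrightarrow> h) (at_right 0)" unfolding ab by (rule tendsto_src_curve)
        then have "\<forall>\<^sub>F t in at_right 0. ?h t \<in> G_arrows"
          using topological_tendstoD open_G_arrows gh(3) by blast
        with base_curve_regular[of a] show ?thesis
          by eventually_elim (simp add: mem_G_regular mem_G_arrows G_src_eq_0)
      qed
      with base_curve_regular[of a]
      have "\<forall>\<^sub>F t in at_right 0. (?g t, ?h t) \<in> composable G_groupoid \<and>
          mult H (?g t, ?h t) = mult G_groupoid (?g t, ?h t)"
        by eventually_elim (simp add: reg composable_G_groupoid G_regular_subset)
      then show ?thesis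
        using continuous_on_agree_at_limit[OF _ _ p lim] cont(3,8) comp by simp
    qed
  qed
  moreover have "unit_at H = unit_at G_groupoid"
  proof
    fix x :: "real^2"
    have reg: "unit_at H x = unit_at G_groupoid x" if "x \<noteq> 0" for x
      using ext that by (simp add: extends_groupoid_def regular_groupoid_simps)
    have "unit_at H 0 = unit_at G_groupoid 0"
    proof (rule continuous_on_agree_at_limit[OF cont(4,9) UNIV_I])
      show "((\<lambda>t. t *\<^sub>R axis 1 1 :: real^2) \<longlongrightarrow> 0) (at_right 0)"
        by (rule tendsto_scaleR_at_right_0)
      show "\<forall>\<^sub>F t in at_right 0. t *\<^sub>R axis 1 1 \<in> (UNIV :: (real^2) set) \<and>
          unit_at H (t *\<^sub>R axis 1 1) = unit_at G_groupoid (t *\<^sub>R axis 1 1)"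
        using eventually_at_right_less[of 0] by eventually_elim (simp add: reg axis_1_nonzero)
    qed
    then show "unit_at H x = unit_at G_groupoid x"
      using reg by (cases "x = 0") auto
  qed
  ultimately show ?thesis
    using sets by (intro groupoid.equality) auto
qed


section \<open>The Lie algebroid of the groupoid\<close>

text \<open>At the unit (x, 0) the source has derivative v1 + |x|^2 v2. Its kernel is parametrised
  by w = v2, and the anchor becomes w to -|x|^2 w, whose image on sections is spanned by r^2 times
  the coordinate fields.\<close>

lemma algebroid_of_G_groupoid:
  "base (algebroid_of G_groupoid) = UNIV"
  "fibre (algebroid_of G_groupoid) x = {v. fst v = - ((x \<bullet> x) *\<^sub>R snd v)}"
  "anchor (algebroid_of G_groupoid) x = fst"
  by (simp_all add: algebroid_of_def frechet_derivative_src_G_groupoid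
      frechet_derivative_tgt_G_groupoid mem_G_arrows dilation_unit eq_neg_iff_add_eq_0)

text \<open>Derivatives within a set are not unique, but they agree on velocities of curves in the set.\<close>

lemma has_derivative_within_unique_along_curve:
  fixes \<gamma> :: "real \<Rightarrow> 'a::real_normed_vector"
  assumes D: "(f has_derivative D) (at (\<gamma> 0) within S)" "(f has_derivative D') (at (\<gamma> 0) within S)"
    and \<gamma>: "(\<gamma> has_derivative (\<lambda>t. t *\<^sub>R u)) (at 0)"
    and S: "open T" "0 \<in> T" "\<And>t. t \<in> T \<Longrightarrow> \<gamma> t \<in> S"
  shows "D u = D' u"
proof -
  have \<gamma>T: "(\<gamma> has_derivative (\<lambda>t. t *\<^sub>R u)) (at 0 within T)"
    using \<gamma> has_derivative_at_withinI by blast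
  have sub: "\<gamma> ` T \<subseteq> S"
    using S(3) by blast
  \<comment> \<open>Along the curve both candidates differentiate the same function of one real
    variable at a point of an open set, where derivatives are unique.\<close>
  have "((\<lambda>t. f (\<gamma> t)) has_derivative (\<lambda>t. D (t *\<^sub>R u))) (at 0)"
    "((\<lambda>t. f (\<gamma> t)) has_derivative (\<lambda>t. D' (t *\<^sub>R u))) (at 0)"
    using has_derivative_in_compose[OF \<gamma>T has_derivative_subset[OF D(1) sub]]
      has_derivative_in_compose[OF \<gamma>T has_derivative_subset[OF D(2) sub]]
    by (simp_all add: at_within_open[OF S(2,1)])
  then have "(\<lambda>t. D (t *\<^sub>R u)) = (\<lambda>t. D' (t *\<^sub>R u))"
    by (rule has_derivative_unique)
  from fun_cong[OF this, of 1] show ?thesis by simp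
qed

lemma has_derivative_dilation_unit:
  "(dilation has_derivative (\<lambda>v. 2 * (x \<bullet> snd v))) (at (x, 0))"
  unfolding dilation_def[abs_def]
  by (auto intro!: derivative_eq_intros)

text \<open>The formula \<open>G_mult k g\<close> makes sense for every \<open>k\<close>, so right
  translation can be differentiated on the whole space; only the derivative of q at the unit
  contributes beyond the identity.\<close>

lemma has_derivative_G_mult_unit:
  "((\<lambda>k. G_mult k g) has_derivative (\<lambda>v. (fst v, snd v + (2 * (x \<bullet> snd v)) *\<^sub>R snd g))) (at (x, 0))"
  unfolding G_mult_def
  by (auto intro!: derivative_eq_intros has_derivative_dilation_unit)

text \<open>The curve \<open>t \<mapsto> (x, - t w)\<^sup>-\<^sup>1\<close> in the source fibre over \<open>x\<close> has velocity \<open>(- |x|\<^sup>2 w, w)\<close>.\<close>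

lemma G_inv_curve:
  fixes x w :: "real^2"
  defines "\<gamma> \<equiv> \<lambda>t. G_inv (x, - (t *\<^sub>R w))"
  shows "(\<gamma> has_derivative (\<lambda>t. t *\<^sub>R (- ((x \<bullet> x) *\<^sub>R w), w))) (at 0)"
proof -
  define q where "q t = dilation (x, - (t *\<^sub>R w))" for t
  have q: "q t = 1 - 2 * t * (x \<bullet> w) + t\<^sup>2 * ((x \<bullet> x) * (w \<bullet> w))" for t
    by (simp add: q_def dilation_def power2_eq_square algebra_simps)
  \<comment> \<open>As q(0) = 1, the factor 1/q does not affect the velocity at t = 0.\<close>
  have "((\<lambda>t. inverse (q t) * t) has_field_derivative 1) (at 0)"
    unfolding q by (auto intro!: derivative_eq_intros)
  then have r: "((\<lambda>t. inverse (q t) * t) has_derivative (\<lambda>t. t)) (at 0)"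
    unfolding has_field_derivative_def by (rule has_derivative_eq_rhs) auto
  have "((\<lambda>t. (x - ((x \<bullet> x) * t) *\<^sub>R w, (inverse (q t) * t) *\<^sub>R w)) has_derivative
      (\<lambda>t. (- (((x \<bullet> x) * t) *\<^sub>R w), t *\<^sub>R w))) (at 0)"
    by (intro has_derivative_Pair bounded_linear.has_derivative[OF bounded_linear_scaleR_left r])
      (auto intro!: derivative_eq_intros)
  then show ?thesis
    by (simp add: \<gamma>_def G_inv_def G_src_def q_def mult.commute)
qed

lemma right_invariant_G_groupoid:
  assumes g: "g \<in> G_arrows" and \<sigma>: "\<sigma> (fst g) \<in> fibre (algebroid_of G_groupoid) (fst g)"
  shows "right_invariant G_groupoid \<sigma> g =
    (fst (\<sigma> (fst g)), snd (\<sigma> (fst g)) + (2 * (fst g \<bullet> snd (\<sigma> (fst g)))) *\<^sub>R snd g)"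
proof -
  define x w where "x = fst g" and "w = snd (\<sigma> x)"
  have \<sigma>x: "\<sigma> x = (- ((x \<bullet> x) *\<^sub>R w), w)"
    using \<sigma> by (simp add: algebroid_of_G_groupoid x_def w_def prod_eq_iff)
  define S where "S = {k \<in> G_arrows. src G_groupoid k = x}"
  let ?f = "\<lambda>k. mult G_groupoid (k, g)"
  have unit: "(x, 0) \<in> S"
    by (simp add: S_def mem_G_arrows dilation_unit G_src_unit)
  have eq: "?f k = G_mult k g" if "k \<in> S" for k
    using that g by (auto simp: S_def x_def mult_G_groupoid composable_G_groupoid)
  \<comment> \<open>The coordinate formula gives one derivative within the source fibre, while
    \<open>frechet_derivative\<close> may choose another. They are compared on the required tangent
    vector by a curve.\<close>
  have D: "(?f has_derivative (\<lambda>v. (fst v, snd v + (2 * (x \<bullet> snd v)) *\<^sub>R snd g))) (at (x, 0) within S)"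
    by (rule has_derivative_transform[OF unit eq has_derivative_at_withinI[OF has_derivative_G_mult_unit]])
  then have D': "(?f has_derivative frechet_derivative ?f (at (x, 0) within S)) (at (x, 0) within S)"
    using differentiableI frechet_derivative_works by blast
  \<comment> \<open>Inverting arrows with target x gives arrows with source x, so this curve lies in
    \<open>S\<close> as long as q does not vanish.\<close>
  let ?\<gamma> = "\<lambda>t. G_inv (x, - (t *\<^sub>R w))"
  have 0: "?\<gamma> 0 = (x, 0)"
    by (simp add: G_inv_def G_src_unit)
  have T: "open {t. dilation (x, - (t *\<^sub>R w)) \<noteq> 0}"
    unfolding dilation_def by (intro open_Collect_neq continuous_intros)
  have "?\<gamma> t \<in> S" if "t \<in> {t. dilation (x, - (t *\<^sub>R w)) \<noteq> 0}" for t
    using that by (simp add: S_def mem_G_arrows dilation_inv G_src_inv)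
  note unique = has_derivative_within_unique_along_curve[where \<gamma> = ?\<gamma>, unfolded 0,
      OF D' D G_inv_curve T _ this]
  have "frechet_derivative ?f (at (x, 0) within S) (- ((x \<bullet> x) *\<^sub>R w), w) =
      (- ((x \<bullet> x) *\<^sub>R w), w + (2 * (x \<bullet> w)) *\<^sub>R snd g)"
    using unique by (simp add: dilation_unit)
  then show ?thesis
    using g by (simp add: right_invariant_def S_def \<sigma>x flip: x_def)
qed

text \<open>The fibre condition eliminates the first component of \<open>\<sigma>\<close>, leaving
  an expression in its second component that can be differentiated near the unit, as the arrows form
  an open set.\<close>

lemma frechet_derivative_right_invariant:
  fixes x :: "real^2"
  assumes \<sigma>: "\<And>y. \<sigma> y \<in> fibre (algebroid_of G_groupoid) y"
    and w: "((\<lambda>y. snd (\<sigma> y)) has_derivative w') (at x)"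
  shows "frechet_derivative (right_invariant G_groupoid \<sigma>) (at (x, 0)) =
    (\<lambda>v. (- ((2 * (x \<bullet> fst v)) *\<^sub>R snd (\<sigma> x) + (x \<bullet> x) *\<^sub>R w' (fst v)),
      w' (fst v) + (2 * (x \<bullet> snd (\<sigma> x))) *\<^sub>R snd v))"
    (is "_ = ?D")
proof -
  have w2 [derivative_intros]: "((\<lambda>g. snd (\<sigma> (fst g))) has_derivative (\<lambda>v. w' (fst v))) (at (x, 0))"
    using has_derivative_compose[OF bounded_linear_imp_has_derivative[OF bounded_linear_fst],
        of "\<lambda>y. snd (\<sigma> y)" w' "(x, 0)" UNIV] w by simp
  have eq: "(- ((fst g \<bullet> fst g) *\<^sub>R snd (\<sigma> (fst g))),
      snd (\<sigma> (fst g)) + (2 * (fst g \<bullet> snd (\<sigma> (fst g)))) *\<^sub>R snd g) = right_invariant G_groupoid \<sigma> g"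
    if "g \<in> G_arrows" for g
    using \<sigma>[of "fst g"] by (simp add: right_invariant_G_groupoid[where \<sigma> = \<sigma>, OF that \<sigma>] algebroid_of_G_groupoid)
  have "((\<lambda>g. (- ((fst g \<bullet> fst g) *\<^sub>R snd (\<sigma> (fst g))),
      snd (\<sigma> (fst g)) + (2 * (fst g \<bullet> snd (\<sigma> (fst g)))) *\<^sub>R snd g)) has_derivative ?D) (at (x, 0))"
    by (intro has_derivative_Pair)
      (auto intro!: derivative_eq_intros simp: fun_eq_iff inner_commute algebra_simps)
  then have "(right_invariant G_groupoid \<sigma> has_derivative ?D) (at (x, 0))"
    by (rule has_derivative_transform_within_open[OF _ open_G_arrows])
      (simp_all add: eq mem_G_arrows dilation_unit)
  then show ?thesis
    by (rule frechet_derivative_at[symmetric])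
qed

text \<open>A fibre element is determined by its second component, which is all that the isomorphism
  reads, so this half of the bracket suffices. The terms with factor 2 come from the dependence of
  the right-invariant fields on a.\<close>

lemma snd_bracket_G_groupoid:
  fixes x :: "real^2"
  assumes \<sigma>: "\<And>y. \<sigma> y \<in> fibre (algebroid_of G_groupoid) y" "((\<lambda>y. snd (\<sigma> y)) has_derivative w') (at x)"
    and \<tau>: "\<And>y. \<tau> y \<in> fibre (algebroid_of G_groupoid) y" "((\<lambda>y. snd (\<tau> y)) has_derivative u') (at x)"
  shows "snd (bracket (algebroid_of G_groupoid) \<sigma> \<tau> x) =
    - ((x \<bullet> x) *\<^sub>R (u' (snd (\<sigma> x)) - w' (snd (\<tau> x))))
    + (2 * (x \<bullet> snd (\<tau> x))) *\<^sub>R snd (\<sigma> x) - (2 * (x \<bullet> snd (\<sigma> x))) *\<^sub>R snd (\<tau> x)"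
proof -
  interpret w': bounded_linear w' using \<sigma>(2) by (rule has_derivative_bounded_linear)
  interpret u': bounded_linear u' using \<tau>(2) by (rule has_derivative_bounded_linear)
  have "(x, 0) \<in> G_arrows" by (simp add: mem_G_arrows dilation_unit)
  moreover have "fst (\<sigma> x) = - ((x \<bullet> x) *\<^sub>R snd (\<sigma> x))" "fst (\<tau> x) = - ((x \<bullet> x) *\<^sub>R snd (\<tau> x))"
    using \<sigma>(1) \<tau>(1) by (simp_all add: algebroid_of_G_groupoid)
  ultimately have "right_invariant G_groupoid \<sigma> (x, 0) = (- ((x \<bullet> x) *\<^sub>R snd (\<sigma> x)), snd (\<sigma> x))"
      "right_invariant G_groupoid \<tau> (x, 0) = (- ((x \<bullet> x) *\<^sub>R snd (\<tau> x)), snd (\<tau> x))"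
    using right_invariant_G_groupoid[of "(x, 0)" \<sigma>] right_invariant_G_groupoid[of "(x, 0)" \<tau>]
      \<sigma>(1)[of x] \<tau>(1)[of x] by simp_all
  then show ?thesis
    by (simp add: algebroid_of_def lie_bracket_def frechet_derivative_right_invariant[OF \<sigma>]
        frechet_derivative_right_invariant[OF \<tau>]
        w'.scaleR u'.scaleR w'.neg u'.neg algebra_simps)
qed


section \<open>The cotangent Lie algebroid\<close>

text \<open>Contraction of the area form with \<open>w\<close> in its second slot. Multiplied by f,
  it is the one-form that the Poisson anchor sends to -|x|^2 w.\<close>

definition covector :: "real^2 \<Rightarrow> ((real^2) \<Rightarrow>\<^sub>L real)" where
  "covector w = blinfun_inner_left (vector [w$2, - (w$1)])"

lemma covector_apply: "blinfun_apply (covector w) z = z$1 * w$2 - z$2 * w$1"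
  by (simp add: covector_def inner_vec_def sum_2)

lemma bounded_linear_covector: "bounded_linear covector"
  unfolding linear_conv_bounded_linear[symmetric]
  by (intro linearI blinfun_eqI)
    (simp_all add: covector_apply plus_blinfun.rep_eq scaleR_blinfun.rep_eq algebra_simps)

section \<open>Elliptic symplectic forms and their Poisson anchors\<close>

lemma real2_eq_axis: "(v :: real^2) = v$1 *\<^sub>R axis 1 1 + v$2 *\<^sub>R axis 2 1"
  by (simp add: vec_eq_iff forall_2 axis_def)

lemma linear_real2:
  assumes "linear f"
  shows "f (v :: real^2) = v$1 *\<^sub>R f (axis 1 1) + v$2 *\<^sub>R f (axis 2 1)"
  by (subst real2_eq_axis[of v]) (simp add: linear_add[OF assms] linear_cmul[OF assms])

lemma inner_real2: "(v :: real^2) \<bullet> w = v$1 * w$1 + v$2 * w$2"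
  by (simp add: inner_vec_def sum_2)

text \<open>An alternating form on a plane is a multiple of the determinant; the coefficient is the
  function f of the overview.\<close>

lemma elliptic_form_eq:
  assumes "elliptic_symplectic \<omega>"
  shows "\<omega> x a b = \<omega> x (axis 1 1) (axis 2 1) * (a$1 * b$2 - a$2 * b$1)"
proof -
  have bil: "bilinear (\<omega> x)" and alt: "\<And>a. \<omega> x a a = 0"
    using assms by (auto simp: elliptic_symplectic_def)
  have "\<omega> x (axis 1 1 + axis 2 1) (axis 1 1 + axis 2 1) = 0" by (rule alt)
  then have "\<omega> x (axis 1 1) (axis 2 1) + \<omega> x (axis 2 1) (axis 1 1) = 0"
    by (simp add: bilinear_ladd[OF bil] bilinear_radd[OF bil] alt[of "axis 1 1"] alt[of "axis 2 1"])
  then have skew: "\<omega> x (axis 2 1) (axis 1 1) = - \<omega> x (axis 1 1) (axis 2 1)"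
    by linarith
  show ?thesis
    by (subst real2_eq_axis[of a], subst real2_eq_axis[of b])
      (simp add: bilinear_ladd[OF bil] bilinear_radd[OF bil] bilinear_lmul[OF bil]
        bilinear_rmul[OF bil] alt skew algebra_simps)
qed

lemma elliptic_form_nonzero:
  assumes "elliptic_symplectic \<omega>"
  shows "\<omega> x (axis 1 1) (axis 2 1) \<noteq> 0"
proof
  assume 0: "\<omega> x (axis 1 1) (axis 2 1) = 0"
  have "\<omega> x (axis 1 1) b = 0" for b
    using elliptic_form_eq[OF assms, of x "axis 1 1" b] unfolding 0 by simp
  moreover have "(\<forall>b. \<omega> x (axis 1 1) b = 0) \<longrightarrow> (axis 1 1 :: real^2) = 0"
    using assms unfolding elliptic_symplectic_def by blast
  ultimately show False
    using axis_1_nonzero by blast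
qed

lemma elliptic_poisson_eq:
  assumes "elliptic_symplectic \<omega>"
  shows "elliptic_poisson \<omega> x \<alpha> = ((x \<bullet> x) / \<omega> x (axis 1 1) (axis 2 1)) *\<^sub>R
    vector [blinfun_apply \<alpha> (axis 2 1), - blinfun_apply \<alpha> (axis 1 1)]"
proof -
  define f where "f = \<omega> x (axis 1 1) (axis 2 1)"
  have form: "\<omega> x a b = f * (a$1 * b$2 - a$2 * b$1)" for a b
    unfolding f_def by (rule elliptic_form_eq[OF assms])
  define p q where "p = blinfun_apply \<alpha> (axis 1 1)" and "q = blinfun_apply \<alpha> (axis 2 1)"
  have f: "f \<noteq> 0" using elliptic_form_nonzero[OF assms] by (simp add: f_def)
  have \<alpha>: "blinfun_apply \<alpha> v = v$1 * p + v$2 * q" for v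
    using linear_real2[OF bounded_linear.linear[OF blinfun.bounded_linear_right], of \<alpha> v]
    by (simp add: p_def q_def)
  \<comment> \<open>The two entries solve the equation for b = e2 and b = e1: f a1 is \<alpha> of
    the rotation field and -f a2 is \<alpha> of the Euler field.\<close>
  have "(THE a. \<forall>b. \<omega> x a b = blinfun_apply \<alpha> (elliptic_anchor x b)) =
      vector [(x$1 * q - x$2 * p) / f, - ((x$1 * p + x$2 * q) / f)]"
  proof (rule the_equality)
    show "\<forall>b. \<omega> x (vector [(x$1 * q - x$2 * p) / f, - ((x$1 * p + x$2 * q) / f)]) b =
        blinfun_apply \<alpha> (elliptic_anchor x b)"
      using f by (simp add: form \<alpha> elliptic_anchor_def) (simp add: field_simps)
    fix a assume a: "\<forall>b. \<omega> x a b = blinfun_apply \<alpha> (elliptic_anchor x b)"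
    have "f * (a$1 * b$2 - a$2 * b$1) = (b$1 * x$1 - b$2 * x$2) * p + (b$1 * x$2 + b$2 * x$1) * q" for b :: "real^2"
      using a[rule_format, of b] by (simp add: form \<alpha> elliptic_anchor_def)
    from this[of "axis 1 1"] this[of "axis 2 1"]
    have "f * a$1 = x$1 * q - x$2 * p" "f * a$2 = - (x$1 * p + x$2 * q)"
      by (simp_all add: axis_def)
    then show "a = vector [(x$1 * q - x$2 * p) / f, - ((x$1 * p + x$2 * q) / f)]"
      using f by (simp add: vec_eq_iff forall_2 field_simps)
  qed
  then show ?thesis
    using f unfolding elliptic_poisson_def
    by (simp add: elliptic_anchor_def vec_eq_iff forall_2 inner_real2 flip: f_def p_def q_def)
      (simp add: field_simps)
qed

lemma elliptic_poisson_covector: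
  assumes "elliptic_symplectic \<omega>"
  shows "elliptic_poisson \<omega> x (\<omega> x (axis 1 1) (axis 2 1) *\<^sub>R covector w) = - ((x \<bullet> x) *\<^sub>R w)"
  using elliptic_form_nonzero[OF assms, of x]
  by (simp add: elliptic_poisson_eq[OF assms] scaleR_blinfun.rep_eq covector_apply vec_eq_iff
      forall_2 axis_def)


section \<open>The bracket of one-forms in the covector frame\<close>

lemma lie_derivative_apply:
  assumes "(\<beta> has_derivative \<beta>') (at x)" "(X has_derivative X') (at x)"
  shows "blinfun_apply (lie_derivative X \<beta> x) v = blinfun_apply (\<beta>' (X x)) v + blinfun_apply (\<beta> x) (X' v)"
proof -
  have "bounded_linear (\<lambda>v. blinfun_apply (\<beta>' (X x)) v + blinfun_apply (\<beta> x) (X' v))"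
    using has_derivative_bounded_linear[OF assms(2)]
    by (intro bounded_linear_add blinfun.bounded_linear_right bounded_linear_blinfun_apply)
  then show ?thesis
    unfolding lie_derivative_def frechet_derivative_at[OF assms(1), symmetric]
      frechet_derivative_at[OF assms(2), symmetric]
    by (simp add: bounded_linear_Blinfun_apply)
qed

lemma exterior_d_apply:
  assumes "(h has_derivative h') (at x)"
  shows "blinfun_apply (exterior_d h x) = h'"
  unfolding exterior_d_def frechet_derivative_at[OF assms, symmetric]
  by (rule bounded_linear_Blinfun_apply[OF has_derivative_bounded_linear[OF assms]])

lemma cotangent_bracket_covector:
  fixes f :: "real^2 \<Rightarrow> real" and w u :: "real^2 \<Rightarrow> real^2"
  assumes f: "(f has_derivative f') (at x)"
    and w: "(w has_derivative w') (at x)" and u: "(u has_derivative u') (at x)"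
    and P: "\<And>y v. P y (f y *\<^sub>R covector v) = - ((y \<bullet> y) *\<^sub>R v)"
  shows "bracket (cotangent_algebroid P) (\<lambda>y. f y *\<^sub>R covector (w y)) (\<lambda>y. f y *\<^sub>R covector (u y)) x =
    f x *\<^sub>R covector (- ((x \<bullet> x) *\<^sub>R (u' (w x) - w' (u x)))
      + (2 * (x \<bullet> u x)) *\<^sub>R w x - (2 * (x \<bullet> w x)) *\<^sub>R u x)"
proof (rule blinfun_eqI)
  fix v :: "real^2"
  have cov: "((\<lambda>y. f y *\<^sub>R covector (z y)) has_derivative
      (\<lambda>v. f x *\<^sub>R covector (z' v) + f' v *\<^sub>R covector (z x))) (at x)"
    if "(z has_derivative z') (at x)" for z z'
    by (intro has_derivative_scaleR f bounded_linear.has_derivative[OF bounded_linear_covector] that)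
  have vec: "((\<lambda>y. - ((y \<bullet> y) *\<^sub>R z y)) has_derivative
      (\<lambda>v. - ((2 * (x \<bullet> v)) *\<^sub>R z x + (x \<bullet> x) *\<^sub>R z' v))) (at x)"
    if [derivative_intros]: "(z has_derivative z') (at x)" for z :: "real^2 \<Rightarrow> real^2" and z'
    by (auto intro!: derivative_eq_intros simp: inner_commute algebra_simps)
  have pair: "((\<lambda>y. blinfun_apply (f y *\<^sub>R covector (u y)) (- ((y \<bullet> y) *\<^sub>R w y))) has_derivative
      (\<lambda>v. blinfun_apply (f x *\<^sub>R covector (u x)) (- ((2 * (x \<bullet> v)) *\<^sub>R w x + (x \<bullet> x) *\<^sub>R w' v))
        + blinfun_apply (f x *\<^sub>R covector (u' v) + f' v *\<^sub>R covector (u x)) (- ((x \<bullet> x) *\<^sub>R w x)))) (at x)"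
    by (rule bounded_bilinear.FDERIV[OF bounded_bilinear_blinfun_apply cov[OF u] vec[OF w]])
  have lin: "linear f'" "linear w'" "linear u'"
    using f w u has_derivative_linear by blast+
  note f'_eq = linear_real2[OF lin(1)]
  show "blinfun_apply (bracket (cotangent_algebroid P) (\<lambda>y. f y *\<^sub>R covector (w y))
        (\<lambda>y. f y *\<^sub>R covector (u y)) x) v =
      blinfun_apply (f x *\<^sub>R covector (- ((x \<bullet> x) *\<^sub>R (u' (w x) - w' (u x)))
        + (2 * (x \<bullet> u x)) *\<^sub>R w x - (2 * (x \<bullet> w x)) *\<^sub>R u x)) v"
    unfolding cotangent_algebroid_def algebroid.simps P minus_blinfun.rep_eq
      lie_derivative_apply[OF cov[OF u] vec[OF w]] lie_derivative_apply[OF cov[OF w] vec[OF u]]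
      exterior_d_apply[OF pair]
    by (simp add: plus_blinfun.rep_eq minus_blinfun.rep_eq uminus_blinfun.rep_eq scaleR_blinfun.rep_eq covector_apply
        linear_neg[OF lin(1)] linear_neg[OF lin(2)] linear_neg[OF lin(3)]
        linear_cmul[OF lin(1)] linear_cmul[OF lin(2)] linear_cmul[OF lin(3)])
      (simp add: f'_eq[of v] f'_eq[of "w x"] f'_eq[of "u x"] inner_real2 algebra_simps)
qed

section \<open>The isomorphism with the cotangent Lie algebroid\<close>

lemma integrates_G_groupoid:
  assumes \<omega>: "elliptic_symplectic \<omega>"
  shows "integrates G_groupoid (cotangent_algebroid (elliptic_poisson \<omega>))"
proof -
  define f where "f x = \<omega> x (axis 1 1) (axis 2 1)" for x
  define P where "P = elliptic_poisson \<omega>"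
  define \<Phi> where "\<Phi> x v = f x *\<^sub>R covector (snd v)" for x and v :: "(real^2) \<times> (real^2)"
  \<comment> \<open>If \<alpha> is f times \<open>covector w\<close>, then \<alpha>(e1) = f w2 and
    \<alpha>(e2) = -f w1; this recovers w.\<close>
  define w where "w x \<alpha> = inverse (f x) *\<^sub>R
    (- (blinfun_apply \<alpha> (axis 2 1) *\<^sub>R axis 1 1) + blinfun_apply \<alpha> (axis 1 1) *\<^sub>R (axis 2 1 :: real^2))"
    for x and \<alpha> :: "(real^2) \<Rightarrow>\<^sub>L real"
  define \<Psi> where "\<Psi> x \<alpha> = (- ((x \<bullet> x) *\<^sub>R w x \<alpha>), w x \<alpha>)" for x \<alpha>
  let ?A = "algebroid_of G_groupoid"
  have f0: "f x \<noteq> 0" for x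
    unfolding f_def by (rule elliptic_form_nonzero[OF \<omega>])
  have "smooth_on UNIV f"
    using \<omega> by (simp add: elliptic_symplectic_def f_def[abs_def])
  note Ck_f = smooth_on_UNIV_imp_Ck_on[OF this]
  have Df: "(f has_derivative frechet_derivative f (at x)) (at x)" for x
    using Ck_on_SucE(1)[OF Ck_f UNIV_I] .
  have P: "P y (f y *\<^sub>R covector v) = - ((y \<bullet> y) *\<^sub>R v)" for y v
    unfolding P_def f_def by (rule elliptic_poisson_covector[OF \<omega>])
  have \<Psi>\<Phi>: "\<Psi> x (\<Phi> x v) = v" if "v \<in> fibre ?A x" for x v
  proof -
    have "w x (\<Phi> x v) = snd v"
      using f0[of x] by (simp add: w_def \<Phi>_def covector_apply scaleR_blinfun.rep_eq vec_eq_iff forall_2 axis_def)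
    then show ?thesis
      using that by (simp add: \<Psi>_def algebroid_of_G_groupoid prod_eq_iff)
  qed
  have \<Phi>\<Psi>: "\<Phi> x (\<Psi> x \<alpha>) = \<alpha>" for x \<alpha>
  proof (rule blinfun_eqI)
    fix v
    show "blinfun_apply (\<Phi> x (\<Psi> x \<alpha>)) v = blinfun_apply \<alpha> v"
      using linear_real2[OF bounded_linear.linear[OF blinfun.bounded_linear_right], of \<alpha> v] f0[of x]
      by (simp add: \<Psi>_def \<Phi>_def w_def covector_apply scaleR_blinfun.rep_eq axis_def)
        (simp add: field_simps)
  qed
  have \<Psi>_mem: "\<Psi> x \<alpha> \<in> fibre ?A x" for x \<alpha>
    by (simp add: \<Psi>_def algebroid_of_G_groupoid)
  have bij: "bij_betw (\<Phi> x) (fibre ?A x) UNIV" for x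
    by (rule bij_betwI[where g = "\<Psi> x"]) (simp_all add: \<Psi>\<Phi> \<Phi>\<Psi> \<Psi>_mem)
  \<comment> \<open>Identifying the abstract inverse with \<open>\<Psi>\<close> reduces its
    smoothness to that of an explicit formula.\<close>
  have inv: "inv_into (fibre ?A x) (\<Phi> x) \<alpha> = \<Psi> x \<alpha>" for x \<alpha>
    using bij[of x] by (intro inv_into_f_eq) (simp_all add: bij_betw_def \<Psi>_mem \<Phi>\<Psi>)
  have Ck_f_fst: "Ck_on k UNIV (\<lambda>p. f (fst p))" for k
    by (rule Ck_on_compose_linear[OF bounded_linear_fst Ck_f open_UNIV subset_UNIV])
  have "algebroid_iso ?A (cotangent_algebroid P) \<Phi>"
    unfolding algebroid_iso_def
  proof (intro conjI ballI allI)
    show "base ?A = base (cotangent_algebroid P)"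
      by (simp add: algebroid_of_G_groupoid cotangent_algebroid_def)
    show "bij_betw (\<Phi> x) (fibre ?A x) (fibre (cotangent_algebroid P) x)" for x
      using bij by (simp add: cotangent_algebroid_def)
    show "\<Phi> x (v + v') = \<Phi> x v + \<Phi> x v'" for x v v'
      by (simp add: \<Phi>_def linear_add[OF bounded_linear.linear[OF bounded_linear_covector]]
          scaleR_add_right)
    show "\<Phi> x (c *\<^sub>R v) = c *\<^sub>R \<Phi> x v" for x c v
      by (simp add: \<Phi>_def linear_cmul[OF bounded_linear.linear[OF bounded_linear_covector]])
    show "smooth_on (total_space ?A) (\<lambda>(x, v). \<Phi> x v)"
    proof (rule smooth_onI[OF open_UNIV subset_UNIV])
      show "Ck_on k UNIV (\<lambda>p. f (fst p) *\<^sub>R covector (snd (snd p)))" for k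
        by (intro Ck_on_scaleR Ck_f_fst Ck_on_linear[OF bounded_linear_covector] Ck_on_snd
            Ck_on_ident open_UNIV)
    qed (auto simp: \<Phi>_def)
    show "smooth_on (total_space (cotangent_algebroid P)) (\<lambda>(x, \<alpha>). inv_into (fibre ?A x) (\<Phi> x) \<alpha>)"
    proof (rule smooth_onI[OF open_UNIV subset_UNIV])
      have "Ck_on k UNIV (\<lambda>p. w (fst p) (snd p))" for k
        unfolding w_def using f0
        by (intro Ck_on_intros Ck_f_fst Ck_on_bilinear[OF bounded_bilinear_blinfun_apply] open_UNIV) auto
      then show "Ck_on k UNIV (\<lambda>p. \<Psi> (fst p) (snd p))" for k
        unfolding \<Psi>_def by (intro Ck_on_intros open_UNIV)
    qed (auto simp: inv)
    show "anchor (cotangent_algebroid P) x (\<Phi> x v) = anchor ?A x v" if "v \<in> fibre ?A x" for x v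
      using that by (simp add: cotangent_algebroid_def algebroid_of_G_groupoid \<Phi>_def P)
    fix \<sigma> \<tau> x assume \<sigma>: "\<sigma> \<in> sections ?A" and \<tau>: "\<tau> \<in> sections ?A"
    have D: "\<exists>z'. ((\<lambda>y. snd (s y)) has_derivative z') (at x)" if "s \<in> sections ?A" for s
    proof -
      have "s differentiable (at x)"
        using that smooth_on_UNIV_imp_differentiable[of s x]
        by (simp add: sections_def algebroid_of_G_groupoid)
      then show ?thesis
        unfolding differentiable_def using has_derivative_snd by blast
    qed
    have mem: "\<sigma> y \<in> fibre ?A y" "\<tau> y \<in> fibre ?A y" for y
      using \<sigma> \<tau> by (simp_all add: sections_def algebroid_of_G_groupoid)
    obtain w' u' where d: "((\<lambda>y. snd (\<sigma> y)) has_derivative w') (at x)"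
        "((\<lambda>y. snd (\<tau> y)) has_derivative u') (at x)"
      using D[OF \<sigma>] D[OF \<tau>] by blast
    show "\<Phi> x (bracket ?A \<sigma> \<tau> x) =
        bracket (cotangent_algebroid P) (\<lambda>y. \<Phi> y (\<sigma> y)) (\<lambda>y. \<Phi> y (\<tau> y)) x"
      \<comment> \<open>Both brackets have become f times the covector of the same vector, so the
        two sides coincide literally.\<close>
      unfolding \<Phi>_def cotangent_bracket_covector[OF Df d P]
        snd_bracket_G_groupoid[OF mem(1) d(1) mem(2) d(2)] ..
  qed
  then show ?thesis
    unfolding integrates_def P_def by blast
qed

theorem theorem8p4:
  shows "diffeomorphism_on phi G_regular ((UNIV - {0}) \<times> (UNIV - {0})) \<and>
    (\<exists>!H. is_lie_extension H) \<and>
    (\<forall>H \<omega>. is_lie_extension H \<and> elliptic_symplectic \<omega> \<longrightarrow>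
       integrates H (cotangent_algebroid (elliptic_poisson \<omega>)))"
proof (intro conjI allI impI)
  show "\<exists>!H. is_lie_extension H"
    using is_lie_extension_G_groupoid lie_extension_eq_G_groupoid by blast
  show "integrates H (cotangent_algebroid (elliptic_poisson \<omega>))"
    if "is_lie_extension H \<and> elliptic_symplectic \<omega>" for H \<omega>
    using that integrates_G_groupoid lie_extension_eq_G_groupoid[of H] by simp
qed (rule diffeomorphism_on_phi)

end
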